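(* Let $q\ge 3$ be a prime power. (1) The number of words of weight $4$ of the corner code $\mathsf{H}^{0}_3$ is $$A_4=\frac14\left(\binom{q^3}{3}(q+1)-q^2\binom{q+1}{3}(3q^3+2q^2-8)\right)(q-1)(q^3-3).$$ (2) The number of words of weight $4$ of the edge code $\mathsf{H}^{1}_3$ is $$A_4=q^2\binom{q}{4}(q^4-4q^2+3)+\frac{q^4(q^2-1)^2(q-1)^2}{8}+(q^2-1)\sum_{k=4}^{2q}N_k\binom{k}{4},$$ where $N_k$ is the number of parabolas and non-vertical lines that intersect $\mathcal{H}$ in exactly $k$ points. (3) The number of words of weight $4$ of the edge code $\mathsf{H}^{2}_3$ is $$A_4=q^2(q-1)\binom{q+1}{4}(2q^3-3q^2-4q+9).$$
   Context: Let $\mathcal{H}$ be the Hermitian curve $x^{q+1}=y^q+y$ in the affine plane $(\mathbb{F}_{q^2})^2$, with its $n=q^3$ affine $\mathbb{F}_{q^2}$-rational points $P_1,\dots,P_n$. For a set $\mathcal{B}$ of monomials in $x,y$, the code with parity checks $\mathcal{B}$ is the set of $c\in(\mathbb{F}_{q^2})^n$ with $\sum_{i=1}^n c_i f(P_i)=0$ for all $f\in\mathcal{B}$. The Hermitian codes $\mathsf{H}^{0}_3,\mathsf{H}^{1}_3,\mathsf{H}^{2}_3$ are the codes with parity checks $\{1,x,y\}$, $\{1,x,y,x^2\}$, $\{1,x,y,x^2,xy\}$ respectively; each has minimum distance $3$. Parabolas and non-vertical lines are the curves $y=ax^2+bx+c$ with $a,b,c\in\mathbb{F}_{q^2}$ (parabola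 if $a\ne0$, non-vertical line if $a=0$); intersection points are points of $(\mathbb{F}_{q^2})^2$ counted without multiplicity. *)

theory Defs
  imports Complex_Main "HOL-Library.FuncSet" "HOL-Library.Cardinality"
    "HOL-Number_Theory.Prime_Powers"
begin

definition hermitian_curve :: "nat \<Rightarrow> ('a::field \<times> 'a) set" where
  "hermitian_curve q = {(x, y). x ^ (q + 1) = y ^ q + y}"

(* The exponent pair (i, j) stands for the monomial x^i y^j. *)
type_synonym monomial = "nat \<times> nat"

definition monomial_eval :: "monomial \<Rightarrow> 'a::field \<times> 'a \<Rightarrow> 'a" where
  "monomial_eval m P = fst P ^ fst m * snd P ^ snd m"

(* The coordinates of a word are indexed by the points of the curve themselves instead of by an
   enumeration P_1, ..., P_n of them; \<rightarrow>\<^sub>E fixes the values outside the curve, so that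
   distinct functions are distinct words. *)
definition hermitian_code :: "nat \<Rightarrow> monomial set \<Rightarrow> ('a::field \<times> 'a \<Rightarrow> 'a) set" where
  "hermitian_code q B =
     {c \<in> hermitian_curve q \<rightarrow>\<^sub>E UNIV.
        \<forall>m\<in>B. (\<Sum>P\<in>hermitian_curve q. c P * monomial_eval m P) = 0}"

definition corner_code_H0 :: "nat \<Rightarrow> ('a::field \<times> 'a \<Rightarrow> 'a) set" where
  "corner_code_H0 q = hermitian_code q {(0, 0), (1, 0), (0, 1)}"

definition edge_code_H1 :: "nat \<Rightarrow> ('a::field \<times> 'a \<Rightarrow> 'a) set" where
  "edge_code_H1 q = hermitian_code q {(0, 0), (1, 0), (0, 1), (2, 0)}"

definition edge_code_H2 :: "nat \<Rightarrow> ('a::field \<times> 'a \<Rightarrow> 'a) set" where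
  "edge_code_H2 q = hermitian_code q {(0, 0), (1, 0), (0, 1), (2, 0), (1, 1)}"

definition weight :: "nat \<Rightarrow> ('a::field \<times> 'a \<Rightarrow> 'a) \<Rightarrow> nat" where
  "weight q c = card {P \<in> hermitian_curve q. c P \<noteq> 0}"

definition num_words :: "nat \<Rightarrow> ('a::field \<times> 'a \<Rightarrow> 'a) set \<Rightarrow> nat \<Rightarrow> nat" where
  "num_words q C w = card {c \<in> C. weight q c = w}"

definition parabolas :: "('a::field \<times> 'a) set set" where
  "parabolas = {{(x, y). y = a * x ^ 2 + b * x + c} | a b c. a \<noteq> 0}"

definition non_vertical_lines :: "('a::field \<times> 'a) set set" where
  "non_vertical_lines = {{(x, y). y = b * x + c} | b c. True}"

(* The type argument only supplies the field. Curves are counted as point sets; over a field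
   with more than two elements, distinct coefficients (a, b, c) give distinct point sets. *)
definition num_curves_meeting :: "'a::field itself \<Rightarrow> nat \<Rightarrow> nat \<Rightarrow> nat" where
  "num_curves_meeting _ q k =
     card {C \<in> parabolas \<union> non_vertical_lines. card (C \<inter> (hermitian_curve q :: ('a \<times> 'a) set)) = k}"

end

theory Submission
  imports Defs "HOL-Computational_Algebra.Computational_Algebra"
begin

text \<open>
  Words of weight 4 are grouped by their support \<open>S\<close>, a 4-set of points of the curve. The number
  of words with support exactly \<open>S\<close> depends only on the geometry of \<open>S\<close>: with \<open>Q = q\<^sup>2\<close>, it is
  \<open>(Q - 1) (Q - 3)\<close> when the checks restricted to \<open>S\<close> have rank 2, it is \<open>Q - 1\<close> when they have
  rank 3 and the dependency among the four columns has no zero entry, and it is 0 otherwise.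
  For the checks \<open>1, x, y\<close> the cases are: \<open>S\<close> collinear, no three points of \<open>S\<close> collinear, and
  exactly three points collinear. With \<open>x\<^sup>2\<close> added, rank 2 needs a vertical line, and the second case
  occurs when \<open>S\<close> lies on the graph of a polynomial of degree at most 2 in \<open>x\<close> or consists of two pairs, each
  on a vertical line; adding \<open>x y\<close> leaves only vertical and non-vertical lines.

  The 4-sets of each kind are counted from the intersection numbers of the curve with lines. These
  follow from the fibre sizes of the norm and trace from the field with \<open>Q\<close> elements to the fixed
  field of \<open>z \<mapsto> z\<^sup>q\<close>. Bounding roots of polynomials gives upper bounds on the fibres and on the
  number of values, and counting all elements shows that these bounds are attained.
\<close>

section \<open>Words supported on four given points\<close>

text \<open>The code words with support exactly \<open>S\<close>, restricted to \<open>S\<close>.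
  The curve no longer appears, so these sets can be counted by linear algebra on the points of
  \<open>S\<close> alone.\<close>

definition full_words :: "monomial set \<Rightarrow> ('a::field \<times> 'a) set \<Rightarrow> ('a \<times> 'a \<Rightarrow> 'a) set" where
  "full_words B S = {c \<in> S \<rightarrow>\<^sub>E UNIV - {0}. \<forall>m\<in>B. (\<Sum>P\<in>S. c P * monomial_eval m P) = 0}"

text \<open>Words are partitioned by support. Restriction to the support and extension by zero are
  mutually inverse and preserve every check sum, because terms off the support vanish.\<close>

lemma num_words_eq_sum:
  fixes B :: "monomial set"
  shows "num_words q (hermitian_code q B :: ('a::{finite, field} \<times> 'a \<Rightarrow> 'a) set) w =
    (\<Sum>S | S \<subseteq> hermitian_curve q \<and> card S = w. card (full_words B S :: ('a \<times> 'a \<Rightarrow> 'a) set))"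
proof -
  let ?H = "hermitian_curve q :: ('a \<times> 'a) set"
  let ?C = "hermitian_code q B :: ('a \<times> 'a \<Rightarrow> 'a) set"
  define supp where "supp c = {P \<in> ?H. c P \<noteq> 0}" for c :: "'a \<times> 'a \<Rightarrow> 'a"
  have fin: "finite ?C"
    by (rule finite_subset[OF _ finite_PiE[of ?H "\<lambda>_. UNIV"]]) (auto simp: hermitian_code_def)
  have "num_words q ?C w = card (\<Union>S\<in>{S. S \<subseteq> ?H \<and> card S = w}. {c \<in> ?C. supp c = S})"
    unfolding num_words_def weight_def supp_def by (intro arg_cong[of _ _ card]) auto
  also have "\<dots> = (\<Sum>S | S \<subseteq> ?H \<and> card S = w. card {c \<in> ?C. supp c = S})"
    using fin by (intro card_UN_disjoint) auto
  also have "\<dots> = (\<Sum>S | S \<subseteq> ?H \<and> card S = w. card (full_words B S :: ('a \<times> 'a \<Rightarrow> 'a) set))"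
  proof (intro sum.cong refl)
    fix S assume "S \<in> {S. S \<subseteq> ?H \<and> card S = w}"
    then have S: "S \<subseteq> ?H" by simp
    have sums: "(\<Sum>P\<in>?H. c P * monomial_eval m P) = (\<Sum>P\<in>S. c' P * monomial_eval m P)"
      if "\<And>P. P \<in> S \<Longrightarrow> c P = c' P" "\<And>P. P \<in> ?H - S \<Longrightarrow> c P = 0" for c c' m
      using S that by (intro sum.mono_neutral_cong_right) auto
    show "card {c \<in> ?C. supp c = S} = card (full_words B S :: ('a \<times> 'a \<Rightarrow> 'a) set)"
    proof (rule bij_betw_same_card, rule bij_betwI)
      \<comment> \<open>The extension is zero on the rest of the curve and \<open>undefined\<close>
        off the curve, as the extensional function space in \<open>hermitian_code\<close>
        demands.\<close>
      let ?g = "\<lambda>c P. if P \<in> S then c P else if P \<in> ?H then 0 else undefined"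
      show "(\<lambda>c. restrict c S) \<in> {c \<in> ?C. supp c = S} \<rightarrow> full_words B S"
      proof
        fix c assume c: "c \<in> {c \<in> ?C. supp c = S}"
        then have "(\<Sum>P\<in>?H. c P * monomial_eval m P) = (\<Sum>P\<in>S. restrict c S P * monomial_eval m P)" for m
          using S by (intro sums) (auto simp: supp_def)
        then show "restrict c S \<in> full_words B S"
          using c by (auto simp: full_words_def hermitian_code_def supp_def)
      qed
      show "?g \<in> full_words B S \<rightarrow> {c \<in> ?C. supp c = S}"
      proof
        fix c :: "'a \<times> 'a \<Rightarrow> 'a" assume c: "c \<in> full_words B S"
        then have "(\<Sum>P\<in>?H. ?g c P * monomial_eval m P) = (\<Sum>P\<in>S. c P * monomial_eval m P)" for m
          using S by (intro sums) auto
        moreover have "supp (?g c) = S"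
          using S c PiE_mem[of c S "\<lambda>_. UNIV - {0}"] by (auto simp: full_words_def supp_def)
        ultimately show "?g c \<in> {c \<in> ?C. supp c = S}"
          using S c by (auto simp: full_words_def hermitian_code_def)
      qed
      show "?g (restrict c S) = c" if "c \<in> {c \<in> ?C. supp c = S}" for c
        using that S by (auto simp: fun_eq_iff hermitian_code_def supp_def PiE_def extensional_def)
      show "restrict (?g c) S = c" if "c \<in> full_words B S" for c
        using that by (auto simp: fun_eq_iff full_words_def PiE_def extensional_def)
    qed
  qed
  finally show ?thesis .
qed

text \<open>Passes from words on four named points to 4-tuples, so that the checks become equations
  in four scalar unknowns.\<close>

lemma card_PiE_four_points:
  assumes "distinct [P1, P2, P3, P4]" and
    "\<And>f. f \<in> {P1, P2, P3, P4} \<rightarrow>\<^sub>E U \<Longrightarrow> R f \<longleftrightarrow> R' (f P1) (f P2) (f P3) (f P4)"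
  shows "card {f \<in> {P1, P2, P3, P4} \<rightarrow>\<^sub>E U. R f} =
    card {(a, b, c, d). a \<in> U \<and> b \<in> U \<and> c \<in> U \<and> d \<in> U \<and> R' a b c d}"
proof (rule bij_betw_same_card, rule bij_betwI)
  let ?g = "\<lambda>(a, b, c, d) P. if P = P1 then a else if P = P2 then b
    else if P = P3 then c else if P = P4 then d else undefined"
  show "(\<lambda>f. (f P1, f P2, f P3, f P4)) \<in> {f \<in> {P1, P2, P3, P4} \<rightarrow>\<^sub>E U. R f} \<rightarrow>
      {(a, b, c, d). a \<in> U \<and> b \<in> U \<and> c \<in> U \<and> d \<in> U \<and> R' a b c d}"
    using assms by auto
  show "?g \<in> {(a, b, c, d). a \<in> U \<and> b \<in> U \<and> c \<in> U \<and> d \<in> U \<and> R' a b c d} \<rightarrow>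
      {f \<in> {P1, P2, P3, P4} \<rightarrow>\<^sub>E U. R f}"
  proof
    fix z assume "z \<in> {(a, b, c, d). a \<in> U \<and> b \<in> U \<and> c \<in> U \<and> d \<in> U \<and> R' a b c d}"
    then obtain a b c d where z: "z = (a, b, c, d)" "a \<in> U" "b \<in> U" "c \<in> U" "d \<in> U" "R' a b c d"
      by auto
    then have "?g z \<in> {P1, P2, P3, P4} \<rightarrow>\<^sub>E U"
      by (auto split: if_splits)
    then show "?g z \<in> {f \<in> {P1, P2, P3, P4} \<rightarrow>\<^sub>E U. R f}"
      using assms(2)[of "?g z"] assms(1) z by auto
  qed
  show "?g (f P1, f P2, f P3, f P4) = f" if "f \<in> {f \<in> {P1, P2, P3, P4} \<rightarrow>\<^sub>E U. R f}" for f
    using that by (auto simp: fun_eq_iff PiE_def extensional_def)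
  show "(\<lambda>f. (f P1, f P2, f P3, f P4)) (?g z) = z"
    if "z \<in> {(a, b, c, d). a \<in> U \<and> b \<in> U \<and> c \<in> U \<and> d \<in> U \<and> R' a b c d}" for z
    using that assms(1) by auto
qed

lemma card_four_elementE:
  assumes "card S = 4"
  obtains P1 P2 P3 P4 where "S = {P1, P2, P3, P4}" "distinct [P1, P2, P3, P4]"
  using assms by (auto simp: eval_nat_numeral card_Suc_eq)

text \<open>The hypotheses make \<open>K\<close> the line spanned by \<open>(D1, D2, D3, D4)\<close>
  without the origin. A member with first entry \<open>a\<close> is the multiple by
  \<open>a / D1\<close>; proportionality is stated cross-multiplied to avoid division.\<close>

lemma card_scalar_multiples:
  fixes K :: "('a::{finite, field} \<times> 'a \<times> 'a \<times> 'a) set"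
  assumes "D1 \<noteq> 0"
    and "\<And>a. a \<noteq> 0 \<Longrightarrow> (a * D1, a * D2, a * D3, a * D4) \<in> K"
    and "\<And>a b c d. (a, b, c, d) \<in> K \<Longrightarrow> a \<noteq> 0 \<and> a * D2 = b * D1 \<and> a * D3 = c * D1 \<and> a * D4 = d * D1"
  shows "card K = CARD('a) - 1"
proof -
  have "K = (\<lambda>a. (a * D1, a * D2, a * D3, a * D4)) ` (UNIV - {0})"
  proof (intro equalityI subsetI)
    fix z assume z: "z \<in> K"
    obtain a b c d where [simp]: "z = (a, b, c, d)" by (cases z)
    have "z = (a / D1 * D1, a / D1 * D2, a / D1 * D3, a / D1 * D4)" "a \<noteq> 0"
      using assms(3)[of a b c d] z assms(1) by (auto simp: field_simps)
    then show "z \<in> (\<lambda>a. (a * D1, a * D2, a * D3, a * D4)) ` (UNIV - {0})"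
      using assms(1) by (intro image_eqI[of _ _ "a / D1"]) auto
  qed (use assms(2) in auto)
  moreover have "inj (\<lambda>a. (a * D1, a * D2, a * D3, a * D4))"
    using assms(1) by (simp add: inj_on_def)
  ultimately show ?thesis
    by (simp add: card_image inj_on_subset card_Diff_singleton)
qed

text \<open>Two independent checks leave a plane of solutions, described by the first entry and the
  ratio of the second entry to the first. Three distinct ratios are forbidden, one for each further
  entry that could vanish; this gives the factor \<open>CARD('a) - 3\<close>.\<close>

lemma card_words_line:
  fixes t :: "'b \<Rightarrow> 'a::{finite, field}"
  assumes "card S = 4" "inj_on t S"
  shows "card {c \<in> S \<rightarrow>\<^sub>E UNIV - {0}. sum c S = 0 \<and> (\<Sum>P\<in>S. c P * t P) = 0} =
    (CARD('a) - 1) * (CARD('a) - 3)"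
proof -
  obtain P1 P2 P3 P4 where S: "S = {P1, P2, P3, P4}" and dist: "distinct [P1, P2, P3, P4]"
    using card_four_elementE[OF assms(1)] .
  define t1 t2 t3 t4 where "t1 = t P1" "t2 = t P2" "t3 = t P3" "t4 = t P4"
  note t_def = this
  have ne: "t1 \<noteq> t2" "t1 \<noteq> t3" "t1 \<noteq> t4" "t2 \<noteq> t3" "t2 \<noteq> t4" "t3 \<noteq> t4"
    using assms(2) dist unfolding S t_def by (auto simp: inj_on_def)
  define K where "K = {(a, b, c, d). a \<in> UNIV - {0} \<and> b \<in> UNIV - {0} \<and> c \<in> UNIV - {0} \<and> d \<in> UNIV - {0}
      \<and> (a + b + c + d = 0 \<and> a * t1 + b * t2 + c * t3 + d * t4 = 0)}"
  \<comment> \<open>Solutions have the form \<open>(a, a r, a u, a v)\<close>; the third or fourth coordinate vanishes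
    exactly for the ratios \<open>r\<^sub>1\<close> and \<open>r\<^sub>2\<close>.\<close>
  define r1 r2 where "r1 = (t4 - t1) / (t2 - t4)" "r2 = (t3 - t1) / (t2 - t3)"
  \<comment> \<open>With first entry 1 and second entry \<open>r\<close>, eliminating the fourth
    entry from the two checks yields \<open>u r\<close>; eliminating the third yields
    \<open>v r\<close>.\<close>
  define u where "u r = ((t4 - t1) - r * (t2 - t4)) / (t3 - t4)" for r
  define v where "v r = ((t3 - t1) - r * (t2 - t3)) / (t4 - t3)" for r
  let ?R = "UNIV - {0, r1, r2}"
  have r1: "r = r1 \<longleftrightarrow> u r = 0" for r
    using ne by (auto simp: r1_r2_def u_def field_simps)
  have r2: "r = r2 \<longleftrightarrow> v r = 0" for r
    using ne by (auto simp: r1_r2_def v_def field_simps)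
  have r_ne: "r1 \<noteq> 0" "r2 \<noteq> 0"
    using ne by (auto simp: r1_r2_def)
  \<comment> \<open>A common value would make both last entries vanish and leave a dependency
    between two points with different parameters.\<close>
  have r12: "r1 \<noteq> r2"
  proof
    assume "r1 = r2"
    then have "(t4 - t1) * (t2 - t3) = (t3 - t1) * (t2 - t4)"
      using ne by (simp add: r1_r2_def frac_eq_eq)
    then have "(t1 - t2) * (t3 - t4) = 0" by algebra
    then show False using ne by simp
  qed
  have u_eq: "u r * (t3 - t4) = (t4 - t1) - r * (t2 - t4)" for r
    using ne by (simp add: u_def)
  have v_eq: "v r * (t4 - t3) = (t3 - t1) - r * (t2 - t3)" for r
    using ne by (simp add: v_def)
  have uv1: "1 + r + u r + v r = 0" for r
  proof -
    have "(t3 - t4) * (1 + r + u r + v r) = 0"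
      using u_eq[of r] v_eq[of r] by algebra
    then show ?thesis using ne by simp
  qed
  have uv2: "t1 + r * t2 + u r * t3 + v r * t4 = 0" for r
    using uv1[of r] u_eq[of r] by algebra
  have "K = (\<lambda>(a, r). (a, a * r, a * u r, a * v r)) ` ((UNIV - {0}) \<times> ?R)"
  proof (intro equalityI subsetI)
    fix z assume "z \<in> K"
    then obtain a b c d where z: "z = (a, b, c, d)" "a \<noteq> 0" "b \<noteq> 0" "c \<noteq> 0" "d \<noteq> 0"
      "a + b + c + d = 0" "a * t1 + b * t2 + c * t3 + d * t4 = 0"
      by (auto simp: K_def)
    define r where "r = b / a"
    have b: "b = a * r" using z by (simp add: r_def)
    have "(c - a * u r) * (t3 - t4) = 0"
      using z(6,7) u_eq[of r] unfolding b by algebra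
    then have c: "c = a * u r" using ne by simp
    have d: "d = a * v r"
      using z(6) uv1[of r] unfolding b c by algebra
    have "r \<noteq> 0" "u r \<noteq> 0" "v r \<noteq> 0"
      using z b c d by auto
    then show "z \<in> (\<lambda>(a, r). (a, a * r, a * u r, a * v r)) ` ((UNIV - {0}) \<times> ?R)"
      using z b c d r1 r2 by (intro image_eqI[of _ _ "(a, r)"]) auto
  next
    fix z assume "z \<in> (\<lambda>(a, r). (a, a * r, a * u r, a * v r)) ` ((UNIV - {0}) \<times> ?R)"
    then obtain a r where z: "z = (a, a * r, a * u r, a * v r)" "a \<noteq> 0" "r \<noteq> 0" "r \<noteq> r1" "r \<noteq> r2"
      by auto
    have "a + a * r + a * u r + a * v r = 0"
      using uv1[of r] by algebra
    moreover have "a * t1 + a * r * t2 + a * u r * t3 + a * v r * t4 = 0"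
      using uv2[of r] by algebra
    ultimately show "z \<in> K"
      using z r1 r2 by (auto simp: K_def)
  qed
  moreover have "inj_on (\<lambda>(a, r). (a, a * r, a * u r, a * v r)) ((UNIV - {0}) \<times> ?R)"
    by (auto simp: inj_on_def)
  moreover have "card ?R = CARD('a) - 3"
    using r_ne r12 by (simp add: card_Diff_subset)
  ultimately have "card K = (CARD('a) - 1) * (CARD('a) - 3)"
    by (simp add: card_image card_cartesian_product card_Diff_singleton)
  moreover have "card {c \<in> S \<rightarrow>\<^sub>E UNIV - {0}. sum c S = 0 \<and> (\<Sum>P\<in>S. c P * t P) = 0} = card K"
    unfolding S K_def by (rule card_PiE_four_points[OF dist]) (use dist in \<open>auto simp: t_def add.assoc\<close>)
  ultimately show ?thesis by simp
qed

text \<open>The three Vandermonde rows have rank 3, so the solutions form a line. Its generator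
  consists of minors that are products of differences of distinct parameters, so none of its entries
  is zero.\<close>

lemma card_words_parabola:
  fixes t :: "'b \<Rightarrow> 'a::{finite, field}"
  assumes "card S = 4" "inj_on t S"
  shows "card {c \<in> S \<rightarrow>\<^sub>E UNIV - {0}. sum c S = 0 \<and> (\<Sum>P\<in>S. c P * t P) = 0
    \<and> (\<Sum>P\<in>S. c P * t P ^ 2) = 0} = CARD('a) - 1"
proof -
  obtain P1 P2 P3 P4 where S: "S = {P1, P2, P3, P4}" and dist: "distinct [P1, P2, P3, P4]"
    using card_four_elementE[OF assms(1)] .
  define t1 t2 t3 t4 where "t1 = t P1" "t2 = t P2" "t3 = t P3" "t4 = t P4"
  note t_def = this
  have ne: "t1 \<noteq> t2" "t1 \<noteq> t3" "t1 \<noteq> t4" "t2 \<noteq> t3" "t2 \<noteq> t4" "t3 \<noteq> t4"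
    using assms(2) dist unfolding S t_def by (auto simp: inj_on_def)
  define K where "K = {(a, b, c, d). a \<in> UNIV - {0} \<and> b \<in> UNIV - {0} \<and> c \<in> UNIV - {0} \<and> d \<in> UNIV - {0}
      \<and> (a + b + c + d = 0 \<and> a * t1 + b * t2 + c * t3 + d * t4 = 0
        \<and> a * t1 ^ 2 + b * t2 ^ 2 + c * t3 ^ 2 + d * t4 ^ 2 = 0)}"
  \<comment> \<open>signed maximal minors of the \<open>3 \<times> 4\<close> Vandermonde matrix\<close>
  define D1 D2 D3 D4 where "D1 = (t2 - t3) * (t2 - t4) * (t3 - t4)"
    "D2 = - ((t1 - t3) * (t1 - t4) * (t3 - t4))" "D3 = (t1 - t2) * (t1 - t4) * (t2 - t4)"
    "D4 = - ((t1 - t2) * (t1 - t3) * (t2 - t3))"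
  note D_def = this
  have D_ne: "D1 \<noteq> 0" "D2 \<noteq> 0" "D3 \<noteq> 0" "D4 \<noteq> 0"
    using ne by (auto simp: D_def)
  have "card K = CARD('a) - 1"
  proof (rule card_scalar_multiples[of D1 D2 D3 D4])
    fix a :: 'a assume "a \<noteq> 0"
    moreover have "a * D1 + a * D2 + a * D3 + a * D4 = 0"
      "a * D1 * t1 + a * D2 * t2 + a * D3 * t3 + a * D4 * t4 = 0"
      "a * D1 * t1 ^ 2 + a * D2 * t2 ^ 2 + a * D3 * t3 ^ 2 + a * D4 * t4 ^ 2 = 0"
      unfolding D_def by algebra+
    ultimately show "(a * D1, a * D2, a * D3, a * D4) \<in> K"
      using D_ne by (simp add: K_def)
  next
    fix a b c d assume "(a, b, c, d) \<in> K"
    then have "a \<noteq> 0" and e: "a + b + c + d = 0" "a * t1 + b * t2 + c * t3 + d * t4 = 0"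
      "a * t1 ^ 2 + b * t2 ^ 2 + c * t3 ^ 2 + d * t4 ^ 2 = 0"
      by (auto simp: K_def)
    moreover have "a * D2 = b * D1" "a * D3 = c * D1" "a * D4 = d * D1"
      using e unfolding D_def by algebra+
    ultimately show "a \<noteq> 0 \<and> a * D2 = b * D1 \<and> a * D3 = c * D1 \<and> a * D4 = d * D1"
      by simp
  qed (use D_ne in auto)
  moreover have "card {c \<in> S \<rightarrow>\<^sub>E UNIV - {0}. sum c S = 0 \<and> (\<Sum>P\<in>S. c P * t P) = 0
    \<and> (\<Sum>P\<in>S. c P * t P ^ 2) = 0} = card K"
    unfolding S K_def by (rule card_PiE_four_points[OF dist]) (use dist in \<open>auto simp: t_def add.assoc\<close>)
  ultimately show ?thesis by simp
qed

text \<open>The determinant with rows \<open>(1, x, y)\<close> at the three points; it vanishes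
  exactly when they are collinear.\<close>

definition area :: "'a::comm_ring_1 \<times> 'a \<Rightarrow> 'a \<times> 'a \<Rightarrow> 'a \<times> 'a \<Rightarrow> 'a" where
  "area P Q R = (fst Q - fst P) * (snd R - snd P) - (fst R - fst P) * (snd Q - snd P)"

text \<open>Cramer's rule: the signed areas are the maximal minors of the \<open>3 \<times> 4\<close> matrix of the checks
  \<open>1, x, y\<close>.\<close>

lemma area_dependency:
  fixes P1 P2 P3 P4 :: "'a::idom \<times> 'a"
  assumes "a + b + c + d = 0"
    and "a * fst P1 + b * fst P2 + c * fst P3 + d * fst P4 = 0"
    and "a * snd P1 + b * snd P2 + c * snd P3 + d * snd P4 = 0"
  shows "a * area P1 P3 P4 = - (b * area P2 P3 P4)" "a * area P1 P2 P4 = c * area P2 P3 P4"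
    "a * area P1 P2 P3 = - (d * area P2 P3 P4)"
  using assms unfolding area_def by algebra+

text \<open>The vector of signed minors spans the solutions, and here it has no zero entry.\<close>

lemma card_words_general_position:
  fixes P1 P2 P3 P4 :: "'a::{finite, field} \<times> 'a"
  assumes dist: "distinct [P1, P2, P3, P4]"
    and ne: "area P2 P3 P4 \<noteq> 0" "area P1 P3 P4 \<noteq> 0" "area P1 P2 P4 \<noteq> 0" "area P1 P2 P3 \<noteq> 0"
    and S: "S = {P1, P2, P3, P4}"
  shows "card {c \<in> S \<rightarrow>\<^sub>E UNIV - {0}. sum c S = 0 \<and> (\<Sum>P\<in>S. c P * fst P) = 0
    \<and> (\<Sum>P\<in>S. c P * snd P) = 0} = CARD('a) - 1"
proof -
  define K where "K = {(a, b, c, d). a \<in> UNIV - {0} \<and> b \<in> UNIV - {0} \<and> c \<in> UNIV - {0} \<and> d \<in> UNIV - {0}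
      \<and> (a + b + c + d = 0 \<and> a * fst P1 + b * fst P2 + c * fst P3 + d * fst P4 = 0
        \<and> a * snd P1 + b * snd P2 + c * snd P3 + d * snd P4 = 0)}"
  define D1 D2 D3 D4 where "D1 = area P2 P3 P4" "D2 = - area P1 P3 P4" "D3 = area P1 P2 P4"
    "D4 = - area P1 P2 P3"
  note D_def = this
  have D_ne: "D1 \<noteq> 0" "D2 \<noteq> 0" "D3 \<noteq> 0" "D4 \<noteq> 0"
    using ne by (auto simp: D_def)
  have "card K = CARD('a) - 1"
  proof (rule card_scalar_multiples[of D1 D2 D3 D4])
    fix a :: 'a assume "a \<noteq> 0"
    moreover have "a * D1 + a * D2 + a * D3 + a * D4 = 0"
      "a * D1 * fst P1 + a * D2 * fst P2 + a * D3 * fst P3 + a * D4 * fst P4 = 0"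
      "a * D1 * snd P1 + a * D2 * snd P2 + a * D3 * snd P3 + a * D4 * snd P4 = 0"
      unfolding D_def area_def by algebra+
    ultimately show "(a * D1, a * D2, a * D3, a * D4) \<in> K"
      using D_ne by (simp add: K_def)
  next
    fix a b c d assume "(a, b, c, d) \<in> K"
    then show "a \<noteq> 0 \<and> a * D2 = b * D1 \<and> a * D3 = c * D1 \<and> a * D4 = d * D1"
      using area_dependency[of a b c d P1 P2 P3 P4] by (auto simp: K_def D_def)
  qed (use D_ne in auto)
  moreover have "card {c \<in> S \<rightarrow>\<^sub>E UNIV - {0}. sum c S = 0 \<and> (\<Sum>P\<in>S. c P * fst P) = 0
    \<and> (\<Sum>P\<in>S. c P * snd P) = 0} = card K"
    unfolding S K_def by (rule card_PiE_four_points[OF dist]) (use dist in \<open>auto simp: add.assoc\<close>)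
  ultimately show ?thesis by simp
qed

text \<open>The checks \<open>1\<close> and \<open>x\<close> force the entries to cancel within each
  pair. The check \<open>x\<^sup>2\<close> then holds automatically, and the check \<open>y\<close>
  fixes the proportion between the two pairs.\<close>

lemma card_words_two_vertical_pairs:
  fixes P1 P2 P3 P4 :: "'a::{finite, field} \<times> 'a"
  assumes dist: "distinct [P1, P2, P3, P4]"
    and fst: "fst P1 = fst P2" "fst P3 = fst P4" "fst P1 \<noteq> fst P3"
    and S: "S = {P1, P2, P3, P4}"
  shows "card {c \<in> S \<rightarrow>\<^sub>E UNIV - {0}. sum c S = 0 \<and> (\<Sum>P\<in>S. c P * fst P) = 0
    \<and> (\<Sum>P\<in>S. c P * snd P) = 0 \<and> (\<Sum>P\<in>S. c P * fst P ^ 2) = 0} = CARD('a) - 1"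
proof -
  define K where "K = {(a, b, c, d). a \<in> UNIV - {0} \<and> b \<in> UNIV - {0} \<and> c \<in> UNIV - {0} \<and> d \<in> UNIV - {0}
      \<and> (a + b + c + d = 0 \<and> a * fst P1 + b * fst P2 + c * fst P3 + d * fst P4 = 0
        \<and> a * snd P1 + b * snd P2 + c * snd P3 + d * snd P4 = 0
        \<and> a * fst P1 ^ 2 + b * fst P2 ^ 2 + c * fst P3 ^ 2 + d * fst P4 ^ 2 = 0)}"
  \<comment> \<open>For entries \<open>(a, - a, c, - c)\<close> the check \<open>y\<close> reads
    \<open>a * f = c * e\<close>, so \<open>(a, c)\<close> is a multiple of
    \<open>(e, f)\<close>.\<close>
  define e f where "e = snd P4 - snd P3" "f = snd P1 - snd P2"
  note ef_def = this
  have ne: "e \<noteq> 0" "f \<noteq> 0"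
    using dist fst by (auto simp: ef_def prod_eq_iff)
  have "card K = CARD('a) - 1"
  proof (rule card_scalar_multiples[of e "- e" f "- f"])
    fix a :: 'a assume "a \<noteq> 0"
    moreover have "a * e + a * (- e) + a * f + a * (- f) = 0"
      "a * e * fst P1 + a * (- e) * fst P2 + a * f * fst P3 + a * (- f) * fst P4 = 0"
      "a * e * fst P1 ^ 2 + a * (- e) * fst P2 ^ 2 + a * f * fst P3 ^ 2 + a * (- f) * fst P4 ^ 2 = 0"
      using fst by simp_all
    moreover have "a * e * snd P1 + a * (- e) * snd P2 + a * f * snd P3 + a * (- f) * snd P4 = 0"
      unfolding ef_def by algebra
    ultimately show "(a * e, a * (- e), a * f, a * (- f)) \<in> K"
      using ne by (simp add: K_def)
  next
    fix a b c d assume "(a, b, c, d) \<in> K"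
    then have "a \<noteq> 0" and k: "a + b + c + d = 0" "a * fst P1 + b * fst P1 + c * fst P3 + d * fst P3 = 0"
      "a * snd P1 + b * snd P2 + c * snd P3 + d * snd P4 = 0"
      using fst by (auto simp: K_def)
    have "(c + d) * (fst P3 - fst P1) = 0"
      using k(1,2) by algebra
    then have cd: "c + d = 0" using fst by simp
    then have ab: "a + b = 0" using k(1) by (metis add.assoc add.right_neutral)
    have "a * (- e) = b * e" "a * f = c * e" "a * (- f) = d * e"
      using ab cd k(3) unfolding ef_def by algebra+
    with \<open>a \<noteq> 0\<close> show "a \<noteq> 0 \<and> a * (- e) = b * e \<and> a * f = c * e \<and> a * (- f) = d * e"
      by simp
  qed (use ne in auto)
  moreover have "card {c \<in> S \<rightarrow>\<^sub>E UNIV - {0}. sum c S = 0 \<and> (\<Sum>P\<in>S. c P * fst P) = 0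
    \<and> (\<Sum>P\<in>S. c P * snd P) = 0 \<and> (\<Sum>P\<in>S. c P * fst P ^ 2) = 0} = card K"
    unfolding S K_def by (rule card_PiE_four_points[OF dist]) (use dist in \<open>auto simp: add.assoc\<close>)
  ultimately show ?thesis by simp
qed

section \<open>Dependence on the position of the four points\<close>

lemma sum_four_points:
  "distinct [P1, P2, P3, P4] \<Longrightarrow> sum f {P1, P2, P3, P4} = f P1 + f P2 + f P3 + (f P4 :: 'a::comm_monoid_add)"
  by (simp add: add.assoc)

lemma card_four_elements_from_twoE:
  assumes "card S = 4" "P1 \<in> S" "P2 \<in> S" "P1 \<noteq> P2"
  obtains P3 P4 where "S = {P1, P2, P3, P4}" "distinct [P1, P2, P3, P4]"
proof -
  have "finite S" using assms(1) by (metis card.infinite zero_neq_numeral)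
  then have "card (S - {P1, P2}) = 2"
    using assms by (simp add: card_Diff_subset)
  then obtain P3 P4 where "S - {P1, P2} = {P3, P4}" "P3 \<noteq> P4"
    by (auto simp: card_2_iff)
  then have "S = {P1, P2, P3, P4}" "distinct [P1, P2, P3, P4]"
    using assms by auto
  then show thesis ..
qed

text \<open>Indexing by a sum type gives every affine line exactly one index, so that counts over
  all lines become sums over a finite type.\<close>

fun line :: "'a::field + 'a \<times> 'a \<Rightarrow> ('a \<times> 'a) set" where
  "line (Inl x) = {P. fst P = x}"
| "line (Inr (b, c)) = {P. snd P = b * fst P + c}"

lemma line_unique:
  assumes "P \<in> line i" "Q \<in> line i" "P \<in> line j" "Q \<in> line j" "P \<noteq> Q"
  shows "i = j"
proof -
  have slope: "b = b' \<and> c = c'"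
    if "snd P = b * fst P + c" "snd Q = b * fst Q + c"
      "snd P = b' * fst P + c'" "snd Q = b' * fst Q + c'" for b c b' c'
  proof -
    have "fst P \<noteq> fst Q" using that(1,2) assms(5) by (auto simp: prod_eq_iff)
    moreover have "(b - b') * (fst P - fst Q) = 0" using that by algebra
    ultimately have "b = b'" by simp
    then show ?thesis using that by simp
  qed
  have vertical: False if "fst P = fst Q" "{P, Q} \<subseteq> line (Inr (b, c))" for b c
    using that assms(5) by (simp add: prod_eq_iff)
  show ?thesis
  proof (cases i rule: line.cases)
    case (1 x)
    then have "fst P = fst Q" using assms(1,2) by simp
    then show ?thesis
      using 1 vertical assms(1,3,4) by (cases j rule: line.cases) auto
  next
    case i: (2 b c)
    then have "fst P \<noteq> fst Q" using vertical assms(1,2) by blast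
    then obtain b' c' where j: "j = Inr (b', c')"
      using assms(3,4) by (cases j rule: line.cases) auto
    show ?thesis
      using slope[of b c b' c'] assms(1-4) unfolding i j by simp
  qed
qed

lemma area_eq_0_imp_collinear:
  assumes "area P Q R = 0" "P \<noteq> Q"
  shows "\<exists>i. {P, Q, R} \<subseteq> line i"
proof (cases "fst P = fst Q")
  case True
  then have "(fst R - fst P) * (snd Q - snd P) = 0"
    using assms(1) by (simp add: area_def)
  moreover have "snd Q \<noteq> snd P"
    using True assms(2) by (auto simp: prod_eq_iff)
  ultimately have "{P, Q, R} \<subseteq> line (Inl (fst P))"
    using True by auto
  then show ?thesis ..
next
  case False
  define b where "b = (snd Q - snd P) / (fst Q - fst P)"
  have b: "b * (fst Q - fst P) = snd Q - snd P"
    using False by (simp add: b_def)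
  have "(snd R - (b * fst R + (snd P - b * fst P))) * (fst Q - fst P) = 0"
    using assms(1) b unfolding area_def by algebra
  then have "snd R = b * fst R + (snd P - b * fst P)"
    using False by simp
  moreover have "snd Q = b * fst Q + (snd P - b * fst P)"
    using b by algebra
  ultimately have "{P, Q, R} \<subseteq> line (Inr (b, snd P - b * fst P))"
    by simp
  then show ?thesis ..
qed

lemma collinear_imp_area_eq_0:
  assumes "{P, Q, R} \<subseteq> line i"
  shows "area P Q R = 0"
proof (cases i rule: line.cases)
  case (1 x)
  then show ?thesis using assms by (simp add: area_def)
next
  case (2 b c)
  then have "snd P = b * fst P + c" "snd Q = b * fst Q + c" "snd R = b * fst R + c"
    using assms by auto
  then show ?thesis unfolding area_def by algebra
qed

section \<open>Words of the three codes supported on a given quadruple\<close>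

abbreviation checks_H0 :: "monomial set" where
  "checks_H0 \<equiv> {(0, 0), (1, 0), (0, 1)}"
abbreviation checks_H1 :: "monomial set" where
  "checks_H1 \<equiv> {(0, 0), (1, 0), (0, 1), (2, 0)}"
abbreviation checks_H2 :: "monomial set" where
  "checks_H2 \<equiv> {(0, 0), (1, 0), (0, 1), (2, 0), (1, 1)}"

lemma full_words_H0:
  "full_words checks_H0 S = {c \<in> S \<rightarrow>\<^sub>E UNIV - {0}. sum c S = 0 \<and> (\<Sum>P\<in>S. c P * fst P) = 0
    \<and> (\<Sum>P\<in>S. c P * snd P) = 0}"
  by (simp add: full_words_def monomial_eval_def)

lemma full_words_H1:
  "full_words checks_H1 S = {c \<in> S \<rightarrow>\<^sub>E UNIV - {0}. sum c S = 0 \<and> (\<Sum>P\<in>S. c P * fst P) = 0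
    \<and> (\<Sum>P\<in>S. c P * snd P) = 0 \<and> (\<Sum>P\<in>S. c P * fst P ^ 2) = 0}"
  by (simp add: full_words_def monomial_eval_def)

lemma full_words_H2:
  "full_words checks_H2 S = {c \<in> S \<rightarrow>\<^sub>E UNIV - {0}. sum c S = 0 \<and> (\<Sum>P\<in>S. c P * fst P) = 0
    \<and> (\<Sum>P\<in>S. c P * snd P) = 0 \<and> (\<Sum>P\<in>S. c P * fst P ^ 2) = 0
    \<and> (\<Sum>P\<in>S. c P * (fst P * snd P)) = 0}"
  by (simp add: full_words_def monomial_eval_def)

lemma full_words_nonzero: "c \<in> full_words B S \<Longrightarrow> P \<in> S \<Longrightarrow> c P \<noteq> 0"
  by (auto simp: full_words_def)

lemma inj_on_snd_vertical: "S \<subseteq> line (Inl x) \<Longrightarrow> inj_on snd S"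
  by (auto simp: inj_on_def prod_eq_iff)

lemma inj_on_fst_nonvertical:
  assumes "S \<subseteq> line (Inr bc)"
  shows "inj_on fst S"
proof (rule inj_onI)
  fix P Q assume "P \<in> S" "Q \<in> S" and eq: "fst P = fst Q"
  then have "P \<in> line (Inr bc)" "Q \<in> line (Inr bc)"
    using assms by auto
  with eq show "P = Q"
    by (cases bc) (simp add: prod_eq_iff)
qed

text \<open>If \<open>g\<close> is a quadratic polynomial in \<open>f\<close> on \<open>S\<close>,
  the check of \<open>g\<close> follows from the checks of \<open>1\<close>, \<open>f\<close> and
  the square of \<open>f\<close>.\<close>

lemma sum_mult_quadratic:
  fixes c :: "'b \<Rightarrow> 'a::comm_ring_1"
  assumes "\<And>P. P \<in> S \<Longrightarrow> g P = k * f P ^ 2 + l * f P + m"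
  shows "(\<Sum>P\<in>S. c P * g P) = k * (\<Sum>P\<in>S. c P * f P ^ 2) + l * (\<Sum>P\<in>S. c P * f P) + m * sum c S"
  using assms by (simp add: sum_distrib_left flip: sum.distrib) (intro sum.cong; simp add: algebra_simps)

text \<open>With \<open>x\<close> constant on \<open>S\<close>, the checks \<open>x\<close> and
  \<open>x\<^sup>2\<close> are multiples of \<open>1\<close>, and \<open>x y\<close> is a multiple
  of \<open>y\<close>. All three codes thus leave the checks \<open>1, y\<close>, with the injective
  parameter \<open>y\<close>.\<close>

lemma card_full_words_vertical:
  fixes S :: "('a::{finite, field} \<times> 'a) set"
  assumes "card S = 4" "S \<subseteq> line (Inl x)"
  shows "card (full_words checks_H0 S) = (CARD('a) - 1) * (CARD('a) - 3)"
    and "card (full_words checks_H1 S) = (CARD('a) - 1) * (CARD('a) - 3)"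
    and "card (full_words checks_H2 S) = (CARD('a) - 1) * (CARD('a) - 3)"
proof -
  have x: "fst P = x" if "P \<in> S" for P using that assms(2) by auto
  have sums: "(\<Sum>P\<in>S. c P * fst P) = sum c S * x" "(\<Sum>P\<in>S. c P * fst P ^ 2) = sum c S * x ^ 2"
    "(\<Sum>P\<in>S. c P * (fst P * snd P)) = x * (\<Sum>P\<in>S. c P * snd P)" for c
    using x by (auto simp: sum_distrib_left sum_distrib_right mult_ac)
  have eq: "full_words B S = {c \<in> S \<rightarrow>\<^sub>E UNIV - {0}. sum c S = 0 \<and> (\<Sum>P\<in>S. c P * snd P) = 0}"
    if "B \<in> {checks_H0, checks_H1, checks_H2}" for B
    using that unfolding insert_iff empty_iff
    by (elim disjE FalseE; hypsubst; unfold full_words_H0 full_words_H1 full_words_H2 sums) auto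
  show "card (full_words checks_H0 S) = (CARD('a) - 1) * (CARD('a) - 3)"
    "card (full_words checks_H1 S) = (CARD('a) - 1) * (CARD('a) - 3)"
    "card (full_words checks_H2 S) = (CARD('a) - 1) * (CARD('a) - 3)"
    by (subst eq, simp, rule card_words_line[OF assms(1) inj_on_snd_vertical[OF assms(2)]])+
qed

lemma card_full_words_H0_line:
  fixes S :: "('a::{finite, field} \<times> 'a) set"
  assumes "card S = 4" "S \<subseteq> line i"
  shows "card (full_words checks_H0 S) = (CARD('a) - 1) * (CARD('a) - 3)"
proof (cases i rule: line.cases)
  case (1 x)
  then show ?thesis using assms card_full_words_vertical(1) by blast
next
  case (2 b k)
  then have "snd P = 0 * fst P ^ 2 + b * fst P + k" if "P \<in> S" for P
    using that assms(2) by auto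
  from sum_mult_quadratic[where g = snd and f = fst and S = S, OF this]
  have "full_words checks_H0 S = {c \<in> S \<rightarrow>\<^sub>E UNIV - {0}. sum c S = 0 \<and> (\<Sum>P\<in>S. c P * fst P) = 0}"
    unfolding full_words_H0 by auto
  then show ?thesis
    using card_words_line[OF assms(1) inj_on_fst_nonvertical] assms(2) 2 by metis
qed

lemma card_full_words_H0_general:
  fixes S :: "('a::{finite, field} \<times> 'a) set"
  assumes "card S = 4" "\<And>i. card (S \<inter> line i) \<le> 2"
  shows "card (full_words checks_H0 S) = CARD('a) - 1"
proof -
  obtain P1 P2 P3 P4 where S: "S = {P1, P2, P3, P4}" and dist: "distinct [P1, P2, P3, P4]"
    using card_four_elementE[OF assms(1)] .
  have "area P Q R \<noteq> 0" if PQR: "{P, Q, R} \<subseteq> S" "distinct [P, Q, R]" for P Q R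
  proof
    assume "area P Q R = 0"
    then obtain i where "{P, Q, R} \<subseteq> line i"
      using area_eq_0_imp_collinear[of P Q R] PQR(2) by auto
    then have "card {P, Q, R} \<le> card (S \<inter> line i)"
      using PQR S by (intro card_mono) auto
    then show False using assms(2)[of i] PQR(2) by simp
  qed
  then show ?thesis
    unfolding full_words_H0
    by (intro card_words_general_position[OF dist _ _ _ _ S]) (use S dist in auto)
qed

text \<open>With three points on a line, Cramer's rule gives that the fourth entry times the area of
  a triple containing the fourth point is zero. As the entry is nonzero, the fourth point would lie
  on the line as well.\<close>

lemma full_words_H0_empty:
  fixes S :: "('a::{finite, field} \<times> 'a) set"
  assumes "card S = 4" "card (S \<inter> line i) \<ge> 3" "\<not> S \<subseteq> line i"
  shows "full_words checks_H0 S = {}"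
proof (rule ccontr)
  assume "full_words checks_H0 S \<noteq> {}"
  then obtain c where c: "c \<in> full_words checks_H0 S" by auto
  have "finite S" using assms(1) by (metis card.infinite zero_neq_numeral)
  then have "card (S \<inter> line i) < 4"
    using assms psubset_card_mono[of S "S \<inter> line i"] by auto
  then have "card (S \<inter> line i) = 3" using assms(2) by simp
  then obtain P1 P2 P3 where P: "S \<inter> line i = {P1, P2, P3}" "distinct [P1, P2, P3]"
    by (auto simp: card_3_iff)
  obtain P4 where P4: "P4 \<in> S" "P4 \<notin> line i" using assms(3) by auto
  have dist: "distinct [P1, P2, P3, P4]" using P P4 by auto
  have S: "S = {P1, P2, P3, P4}"
    using P P4 assms(1) dist \<open>finite S\<close> by (intro card_subset_eq[symmetric]) auto
  have ne: "c P4 \<noteq> 0" "c P1 \<noteq> 0"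
    using full_words_nonzero[OF c] S by auto
  have "area P1 P2 P3 = 0"
    using collinear_imp_area_eq_0[of P1 P2 P3 i] P by auto
  moreover have "c P1 * area P1 P2 P3 = - (c P4 * area P2 P3 P4)"
    using c dist unfolding full_words_H0 S
    by (intro area_dependency(3)[where b = "c P2" and c = "c P3"])
      (auto simp: sum_four_points[OF dist] simp del: distinct.simps)
  ultimately have "area P2 P3 P4 = 0" using ne by simp
  then obtain j where "{P2, P3, P4} \<subseteq> line j"
    using area_eq_0_imp_collinear[of P2 P3 P4] P(2) by auto
  moreover have "P2 \<in> line i" "P3 \<in> line i" "P2 \<noteq> P3" using P by auto
  ultimately have "i = j"
    by (intro line_unique[of P2 _ P3]) auto
  then show False using P4 \<open>{P2, P3, P4} \<subseteq> line j\<close> by simp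
qed

text \<open>Allowing \<open>a = 0\<close> treats parabolas and non-vertical lines uniformly.\<close>

definition quadratic_curve :: "'a::field \<Rightarrow> 'a \<Rightarrow> 'a \<Rightarrow> ('a \<times> 'a) set" where
  "quadratic_curve a b c = {(x, y). y = a * x ^ 2 + b * x + c}"

lemma quadratic_curve_iff: "P \<in> quadratic_curve a b c \<longleftrightarrow> snd P = a * fst P ^ 2 + b * fst P + c"
  by (cases P) (simp add: quadratic_curve_def)

lemma parabolas_Un_lines_eq: "parabolas \<union> non_vertical_lines = {quadratic_curve a b c | a b c. True}"
proof -
  have "quadratic_curve a b c \<in> parabolas \<union> non_vertical_lines" for a b c :: 'a
    by (cases "a = 0") (force simp: parabolas_def non_vertical_lines_def quadratic_curve_def)+
  moreover have "C \<in> {quadratic_curve a b c | a b c. True}" if "C \<in> non_vertical_lines" for C :: "('a \<times> 'a) set"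
  proof -
    from that obtain b c where "C = {(x, y). y = b * x + c}"
      unfolding non_vertical_lines_def by blast
    then have "C = quadratic_curve 0 b c" by (simp add: quadratic_curve_def)
    then show ?thesis by blast
  qed
  moreover have "parabolas \<subseteq> {quadratic_curve a b c | a b c. True}"
    by (auto simp: parabolas_def quadratic_curve_def)
  ultimately show ?thesis
    by blast
qed

lemma interpolate_three_points:
  fixes x1 x2 x3 :: "'a::field"
  assumes "x1 \<noteq> x2" "x1 \<noteq> x3" "x2 \<noteq> x3"
  obtains a b c where "y1 = a * x1 ^ 2 + b * x1 + c" "y2 = a * x2 ^ 2 + b * x2 + c"
    "y3 = a * x3 ^ 2 + b * x3 + c"
proof -
  \<comment> \<open>\<open>m\<close> and \<open>k\<close> are the first and second divided
    differences of Newton interpolation; the witnesses below are the expanded coefficients of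
    \<open>y1 + m (x - x1) + k (x - x1) (x - x2)\<close>.\<close>
  define m where "m = (y2 - y1) / (x2 - x1)"
  define k where "k = ((y3 - y1) - m * (x3 - x1)) / ((x3 - x1) * (x3 - x2))"
  have m: "m * (x2 - x1) = y2 - y1" using assms by (simp add: m_def)
  have k: "k * ((x3 - x1) * (x3 - x2)) = (y3 - y1) - m * (x3 - x1)" using assms by (simp add: k_def)
  show thesis
  proof (rule that[of k "m - k * (x1 + x2)" "y1 - m * x1 + k * x1 * x2"])
    show "y1 = k * x1 ^ 2 + (m - k * (x1 + x2)) * x1 + (y1 - m * x1 + k * x1 * x2)"
      by algebra
    show "y2 = k * x2 ^ 2 + (m - k * (x1 + x2)) * x2 + (y1 - m * x1 + k * x1 * x2)"
      using m by algebra
    show "y3 = k * x3 ^ 2 + (m - k * (x1 + x2)) * x3 + (y1 - m * x1 + k * x1 * x2)"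
      using k by algebra
  qed
qed

lemma quadratic_curve_inj_on_fst:
  assumes "S \<subseteq> quadratic_curve a b c"
  shows "inj_on fst S"
proof (rule inj_onI)
  fix P Q assume "P \<in> S" "Q \<in> S" and eq: "fst P = fst Q"
  then have "P \<in> quadratic_curve a b c" "Q \<in> quadratic_curve a b c"
    using assms by auto
  with eq show "P = Q"
    by (simp add: quadratic_curve_iff prod_eq_iff)
qed

text \<open>The difference of the two polynomials has degree at most 2 and vanishes at distinct
  abscissae, three of which suffice. This prevents counting a quadruple on two curves.\<close>

lemma quadratic_curve_unique:
  assumes "card S = 4" "S \<subseteq> quadratic_curve a b c" "S \<subseteq> quadratic_curve a' b' c'"
  shows "a = a' \<and> b = b' \<and> c = c'"
proof -
  obtain P1 P2 P3 P4 where S: "S = {P1, P2, P3, P4}" and dist: "distinct [P1, P2, P3, P4]"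
    using card_four_elementE[OF assms(1)] .
  have ne: "fst P1 \<noteq> fst P2" "fst P1 \<noteq> fst P3" "fst P2 \<noteq> fst P3"
    using quadratic_curve_inj_on_fst[OF assms(2)] dist unfolding S by (auto simp: inj_on_def)
  have *: "snd P1 = a * fst P1 ^ 2 + b * fst P1 + c" "snd P2 = a * fst P2 ^ 2 + b * fst P2 + c"
    "snd P3 = a * fst P3 ^ 2 + b * fst P3 + c" "snd P1 = a' * fst P1 ^ 2 + b' * fst P1 + c'"
    "snd P2 = a' * fst P2 ^ 2 + b' * fst P2 + c'" "snd P3 = a' * fst P3 ^ 2 + b' * fst P3 + c'"
    using assms(2,3) unfolding S by (auto simp: quadratic_curve_iff)
  have d: "(a - a') * x ^ 2 + (b - b') * x + (c - c') = 0"
    if "x \<in> fst ` {P1, P2, P3}" for x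
    using that * by (elim imageE insertE emptyE; hypsubst) (simp_all add: algebra_simps)
  have "(a - a') * ((fst P1 - fst P2) * (fst P1 - fst P3) * (fst P2 - fst P3)) = 0"
    using d[of "fst P1"] d[of "fst P2"] d[of "fst P3"] by simp algebra
  then have a: "a = a'" using ne by simp
  have "(b - b') * (fst P1 - fst P2) = 0" using * unfolding a by algebra
  then have b: "b = b'" using ne by simp
  then show ?thesis using *(1,4) a by simp
qed

lemma card_full_words_H1_curve:
  fixes S :: "('a::{finite, field} \<times> 'a) set"
  assumes "card S = 4" "S \<subseteq> quadratic_curve k l m"
  shows "card (full_words checks_H1 S) = CARD('a) - 1"
proof -
  have "snd P = k * fst P ^ 2 + l * fst P + m" if "P \<in> S" for P
    using that assms(2) by (auto simp: quadratic_curve_iff)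
  from sum_mult_quadratic[where g = snd and f = fst and S = S, OF this]
  have "full_words checks_H1 S = {c \<in> S \<rightarrow>\<^sub>E UNIV - {0}. sum c S = 0 \<and> (\<Sum>P\<in>S. c P * fst P) = 0
    \<and> (\<Sum>P\<in>S. c P * fst P ^ 2) = 0}"
    unfolding full_words_H1 by auto
  then show ?thesis
    using card_words_parabola[OF assms(1) quadratic_curve_inj_on_fst[OF assms(2)]] by simp
qed

text \<open>On \<open>y = l x + m\<close> both \<open>y\<close> and \<open>x y\<close> are
  polynomials of degree at most 2 in \<open>x\<close>, so exactly the Vandermonde checks
  \<open>1, x, x\<^sup>2\<close> remain.\<close>

lemma card_full_words_H2_line:
  fixes S :: "('a::{finite, field} \<times> 'a) set"
  assumes "card S = 4" "S \<subseteq> line (Inr bc)"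
  shows "card (full_words checks_H2 S) = CARD('a) - 1"
proof -
  obtain l m where bc: "bc = (l, m)" by (cases bc)
  have 1: "snd P = 0 * fst P ^ 2 + l * fst P + m" if "P \<in> S" for P
    using that assms(2) by (auto simp: bc)
  then have 2: "fst P * snd P = l * fst P ^ 2 + m * fst P + 0" if "P \<in> S" for P
    using that by (auto simp: algebra_simps power2_eq_square)
  from sum_mult_quadratic[where g = snd and f = fst and S = S, OF 1]
    sum_mult_quadratic[where g = "\<lambda>P. fst P * snd P" and f = fst and S = S, OF 2]
  have "full_words checks_H2 S = {c \<in> S \<rightarrow>\<^sub>E UNIV - {0}. sum c S = 0 \<and> (\<Sum>P\<in>S. c P * fst P) = 0
    \<and> (\<Sum>P\<in>S. c P * fst P ^ 2) = 0}"
    unfolding full_words_H2 by auto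
  then show ?thesis
    using card_words_parabola[OF assms(1) inj_on_fst_nonvertical[OF assms(2)]] by simp
qed

text \<open>Phrased through the image and the fibres of \<open>fst\<close>, which suits a count that
  first chooses the two abscissae and then a pair above each.\<close>

definition two_vertical_pairs :: "('a \<times> 'b) set \<Rightarrow> bool" where
  "two_vertical_pairs S \<longleftrightarrow> card (fst ` S) = 2 \<and> (\<forall>x\<in>fst ` S. card {P \<in> S. fst P = x} = 2)"

lemma two_vertical_pairsI:
  assumes "distinct [P1, P2, P3, P4]" "fst P1 = fst P2" "fst P3 = fst P4" "fst P1 \<noteq> fst P3"
  shows "two_vertical_pairs {P1, P2, P3, P4}"
proof -
  have "{P \<in> {P1, P2, P3, P4}. fst P = fst P1} = {P1, P2}"
    "{P \<in> {P1, P2, P3, P4}. fst P = fst P3} = {P3, P4}"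
    using assms by auto
  then show ?thesis
    using assms by (simp add: two_vertical_pairs_def)
qed

lemma two_vertical_pairsE:
  assumes "two_vertical_pairs S"
  obtains P1 P2 P3 P4 where "S = {P1, P2, P3, P4}" "distinct [P1, P2, P3, P4]"
    "fst P1 = fst P2" "fst P3 = fst P4" "fst P1 \<noteq> fst P3"
proof -
  obtain x x' where x: "fst ` S = {x, x'}" "x \<noteq> x'"
    using assms by (auto simp: two_vertical_pairs_def card_2_iff)
  then have "card {P \<in> S. fst P = x} = 2" "card {P \<in> S. fst P = x'} = 2"
    using assms by (auto simp: two_vertical_pairs_def)
  then obtain P1 P2 P3 P4 where P: "{P \<in> S. fst P = x} = {P1, P2}" "P1 \<noteq> P2"
    "{P \<in> S. fst P = x'} = {P3, P4}" "P3 \<noteq> P4"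
    by (auto simp: card_2_iff)
  then have fst: "fst P1 = x" "fst P2 = x" "fst P3 = x'" "fst P4 = x'" by auto
  have "S = {P \<in> S. fst P = x} \<union> {P \<in> S. fst P = x'}" using x by auto
  then have "S = {P1, P2, P3, P4}" using P by auto
  moreover have "distinct [P1, P2, P3, P4]" using P(2,4) fst x(2) by auto
  ultimately show thesis using that[of P1 P2 P3 P4] fst x(2) by simp
qed

text \<open>Combining the checks with suitable coefficients isolates one nonzero entry. For distinct
  abscissae this puts the fourth point on the curve interpolating the other three; for a repeated
  abscissa it restricts the two remaining ones.\<close>

lemma full_words_H1_cases:
  fixes S :: "('a::{finite, field} \<times> 'a) set"
  assumes "card S = 4" "w \<in> full_words checks_H1 S"
  shows "(\<exists>x. S \<subseteq> line (Inl x)) \<or> (\<exists>a b c. S \<subseteq> quadratic_curve a b c) \<or> two_vertical_pairs S"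
proof (cases "inj_on fst S")
  case True
  obtain P1 P2 P3 P4 where S: "S = {P1, P2, P3, P4}" and dist: "distinct [P1, P2, P3, P4]"
    using card_four_elementE[OF assms(1)] .
  have ne: "fst P1 \<noteq> fst P2" "fst P1 \<noteq> fst P3" "fst P2 \<noteq> fst P3"
    using True dist unfolding S by (auto simp: inj_on_def)
  obtain a b c where abc: "snd P1 = a * fst P1 ^ 2 + b * fst P1 + c"
    "snd P2 = a * fst P2 ^ 2 + b * fst P2 + c" "snd P3 = a * fst P3 ^ 2 + b * fst P3 + c"
    using interpolate_three_points[OF ne, of "snd P1" "snd P2" "snd P3"] .
  have e: "w P1 + w P2 + w P3 + w P4 = 0"
    "w P1 * fst P1 + w P2 * fst P2 + w P3 * fst P3 + w P4 * fst P4 = 0"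
    "w P1 * snd P1 + w P2 * snd P2 + w P3 * snd P3 + w P4 * snd P4 = 0"
    "w P1 * fst P1 ^ 2 + w P2 * fst P2 ^ 2 + w P3 * fst P3 ^ 2 + w P4 * fst P4 ^ 2 = 0"
    using assms(2) unfolding full_words_H1 S sum_four_points[OF dist] by auto
  \<comment> \<open>The function \<open>y - (a x\<^sup>2 + b x + c)\<close> is a combination of the
    checks and vanishes at the first three points.\<close>
  have "w P4 * (snd P4 - (a * fst P4 ^ 2 + b * fst P4 + c)) =
    (w P1 * snd P1 + w P2 * snd P2 + w P3 * snd P3 + w P4 * snd P4)
    - a * (w P1 * fst P1 ^ 2 + w P2 * fst P2 ^ 2 + w P3 * fst P3 ^ 2 + w P4 * fst P4 ^ 2)
    - b * (w P1 * fst P1 + w P2 * fst P2 + w P3 * fst P3 + w P4 * fst P4)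
    - c * (w P1 + w P2 + w P3 + w P4)"
    unfolding abc by (simp add: algebra_simps)
  also have "\<dots> = 0"
    unfolding e by simp
  finally have "w P4 * (snd P4 - (a * fst P4 ^ 2 + b * fst P4 + c)) = 0" .
  moreover have "w P4 \<noteq> 0"
    using full_words_nonzero[OF assms(2)] S by auto
  ultimately have "snd P4 = a * fst P4 ^ 2 + b * fst P4 + c" by simp
  then have "S \<subseteq> quadratic_curve a b c"
    using abc S by (simp add: quadratic_curve_iff)
  then show ?thesis by blast
next
  case False
  then obtain P1 P2 where "P1 \<in> S" "P2 \<in> S" "P1 \<noteq> P2" and x12: "fst P1 = fst P2"
    by (auto simp: inj_on_def)
  then obtain P3 P4 where S: "S = {P1, P2, P3, P4}" and dist: "distinct [P1, P2, P3, P4]"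
    using card_four_elements_from_twoE[OF assms(1)] by metis
  have e: "w P1 + w P2 + w P3 + w P4 = 0"
    "w P1 * fst P1 + w P2 * fst P2 + w P3 * fst P3 + w P4 * fst P4 = 0"
    "w P1 * fst P1 ^ 2 + w P2 * fst P2 ^ 2 + w P3 * fst P3 ^ 2 + w P4 * fst P4 ^ 2 = 0"
    using assms(2) unfolding full_words_H1 S sum_four_points[OF dist] by auto
  have ne: "w P3 \<noteq> 0" "w P4 \<noteq> 0"
    using full_words_nonzero[OF assms(2)] S by auto
  \<comment> \<open>Evaluate the checks on \<open>(x - x1) (x - x4)\<close>, which vanishes at all
    points but the third, and symmetrically for the fourth.\<close>
  have "w P3 * ((fst P3 - fst P1) * (fst P3 - fst P4)) = 0"
    "w P4 * ((fst P4 - fst P1) * (fst P4 - fst P3)) = 0"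
    using e x12 by algebra+
  then have "(fst P3 - fst P1) * (fst P3 - fst P4) = 0" "(fst P4 - fst P1) * (fst P4 - fst P3) = 0"
    using ne by auto
  then have "(fst P3 = fst P1 \<and> fst P4 = fst P1) \<or> (fst P3 = fst P4 \<and> fst P1 \<noteq> fst P3)"
    by auto
  then show ?thesis
  proof
    assume "fst P3 = fst P1 \<and> fst P4 = fst P1"
    then have "S \<subseteq> line (Inl (fst P1))" using S x12 by auto
    then show ?thesis by blast
  next
    assume "fst P3 = fst P4 \<and> fst P1 \<noteq> fst P3"
    then show ?thesis using two_vertical_pairsI[OF dist x12] S by auto
  qed
qed

text \<open>Starting from the three cases for \<open>checks_H1\<close>, the additional check
  \<open>x y\<close> forces the leading coefficient of the curve to be zero and excludes two
  vertical pairs.\<close>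

lemma full_words_H2_cases:
  fixes S :: "('a::{finite, field} \<times> 'a) set"
  assumes "card S = 4" "w \<in> full_words checks_H2 S"
  shows "(\<exists>x. S \<subseteq> line (Inl x)) \<or> (\<exists>bc. S \<subseteq> line (Inr bc))"
proof -
  have "w \<in> full_words checks_H1 S"
    using assms(2) by (auto simp: full_words_def)
  from full_words_H1_cases[OF assms(1) this]
  consider x where "S \<subseteq> line (Inl x)" | a b c where "S \<subseteq> quadratic_curve a b c" | "two_vertical_pairs S"
    by blast
  then show ?thesis
  proof cases
    case 1
    then show ?thesis by blast
  next
    case (2 a b c)
    obtain P1 P2 P3 P4 where S: "S = {P1, P2, P3, P4}" and dist: "distinct [P1, P2, P3, P4]"
      using card_four_elementE[OF assms(1)] .
    have ne: "fst P4 \<noteq> fst P1" "fst P4 \<noteq> fst P2" "fst P4 \<noteq> fst P3"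
      using quadratic_curve_inj_on_fst[OF 2] dist unfolding S by (auto simp: inj_on_def)
    have abc: "snd P1 = a * fst P1 ^ 2 + b * fst P1 + c" "snd P2 = a * fst P2 ^ 2 + b * fst P2 + c"
      "snd P3 = a * fst P3 ^ 2 + b * fst P3 + c" "snd P4 = a * fst P4 ^ 2 + b * fst P4 + c"
      using 2 S by (auto simp: quadratic_curve_iff)
    have e: "w P1 + w P2 + w P3 + w P4 = 0"
      "w P1 * fst P1 + w P2 * fst P2 + w P3 * fst P3 + w P4 * fst P4 = 0"
      "w P1 * fst P1 ^ 2 + w P2 * fst P2 ^ 2 + w P3 * fst P3 ^ 2 + w P4 * fst P4 ^ 2 = 0"
      "w P1 * (fst P1 * snd P1) + w P2 * (fst P2 * snd P2) + w P3 * (fst P3 * snd P3) + w P4 * (fst P4 * snd P4) = 0"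
      using assms(2) unfolding full_words_H2 S sum_four_points[OF dist] by auto
    have "w P4 \<noteq> 0"
      using full_words_nonzero[OF assms(2)] S by auto
    moreover have "a * (w P4 * ((fst P4 - fst P1) * (fst P4 - fst P2) * (fst P4 - fst P3))) = 0"
    proof -
      let ?m = "\<lambda>f. w P1 * f P1 + w P2 * f P2 + w P3 * f P3 + w P4 * f P4"
      \<comment> \<open>On the curve \<open>x y = a x\<^sup>3 + b x\<^sup>2 + c x\<close>, so the
        checks kill \<open>a\<close> times the cubic moment.\<close>
      have "a * ?m (\<lambda>P. fst P ^ 3) =
        ?m (\<lambda>P. fst P * snd P) - b * ?m (\<lambda>P. fst P ^ 2) - c * ?m fst"
        unfolding abc by (simp add: algebra_simps power2_eq_square power3_eq_cube)
      then have "a * ?m (\<lambda>P. fst P ^ 3) = 0"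
        unfolding e by simp
      \<comment> \<open>The cubic \<open>(x - x1) (x - x2) (x - x3)\<close> leaves only the fourth
        term of the weighted sum; its lower moments vanish by the checks.\<close>
      moreover have "w P4 * ((fst P4 - fst P1) * (fst P4 - fst P2) * (fst P4 - fst P3)) =
        ?m (\<lambda>P. fst P ^ 3) - (fst P1 + fst P2 + fst P3) * ?m (\<lambda>P. fst P ^ 2)
        + (fst P1 * fst P2 + fst P1 * fst P3 + fst P2 * fst P3) * ?m fst
        - fst P1 * fst P2 * fst P3 * (w P1 + w P2 + w P3 + w P4)"
        by (simp add: algebra_simps power2_eq_square power3_eq_cube)
      ultimately show ?thesis
        unfolding e by simp
    qed
    ultimately have "a = 0" using ne by simp
    then have "S \<subseteq> line (Inr (b, c))" using abc S by auto
    then show ?thesis by blast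
  next
    case 3
    then obtain P1 P2 P3 P4 where S: "S = {P1, P2, P3, P4}" and dist: "distinct [P1, P2, P3, P4]"
      and x: "fst P1 = fst P2" "fst P3 = fst P4" "fst P1 \<noteq> fst P3"
      by (rule two_vertical_pairsE)
    have e: "w P1 + w P2 + w P3 + w P4 = 0"
      "w P1 * fst P1 + w P2 * fst P2 + w P3 * fst P3 + w P4 * fst P4 = 0"
      "w P1 * snd P1 + w P2 * snd P2 + w P3 * snd P3 + w P4 * snd P4 = 0"
      "w P1 * (fst P1 * snd P1) + w P2 * (fst P2 * snd P2) + w P3 * (fst P3 * snd P3) + w P4 * (fst P4 * snd P4) = 0"
      using assms(2) unfolding full_words_H2 S sum_four_points[OF dist] by auto
    \<comment> \<open>The function \<open>x - x3\<close> vanishes on the second pair; multiplied by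
      \<open>y\<close> it gives the next identity, which isolates \<open>w P1\<close>.\<close>
    have "(w P1 + w P2) * (fst P1 - fst P3) = 0"
      using e(1,2) x by algebra
    then have w: "w P1 + w P2 = 0" using x by simp
    have "w P1 * ((snd P1 - snd P2) * (fst P1 - fst P3)) = 0"
      using e(3,4) w x(1,2) by algebra
    moreover have "w P1 \<noteq> 0"
      using full_words_nonzero[OF assms(2)] S by auto
    moreover have "snd P1 \<noteq> snd P2" using dist x by (auto simp: prod_eq_iff)
    ultimately show ?thesis using x by simp
  qed
qed

section \<open>Intersections of the Hermitian curve with lines\<close>

lemma finite_field_power_card:
  fixes x :: "'a :: {finite, field}"
  shows "x ^ CARD('a) = x"
proof (cases "x = 0")
  case False
  have "(\<Prod>y\<in>UNIV-{0}. x * y) = x ^ (CARD('a) - 1) * \<Prod>(UNIV-{0})"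
    by (simp add: prod.distrib)
  moreover have "(\<Prod>y\<in>UNIV-{0}. x * y) = \<Prod>(UNIV-{0})"
    by (rule prod.reindex_bij_witness[of _ "\<lambda>y. y / x" "\<lambda>y. x * y"]) (use False in auto)
  ultimately have "x ^ (CARD('a) - 1) = 1"
    by simp
  then show ?thesis
    by (metis finite_UNIV_card_ge_0 finite power_minus_mult mult_1)
qed (simp add: finite_UNIV_card_ge_0)

text \<open>Translation by 1 permutes the ring, so the sum of all elements is unchanged when
  \<open>CARD('a)\<close> ones are added.\<close>

lemma finite_ring_CHAR_dvd_card: "CHAR('a :: {finite, ring_1}) dvd CARD('a)"
proof -
  have "(\<Sum>x\<in>UNIV. x + 1 :: 'a) = (\<Sum>x\<in>UNIV. x)"
    by (rule sum.reindex_bij_witness[of _ "\<lambda>x. x - 1" "\<lambda>x. x + 1"]) auto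
  then show ?thesis
    by (simp add: sum.distrib of_nat_eq_0_iff_char_dvd)
qed

text \<open>Pigeonhole in the extremal case: at most \<open>n\<close> fibres of size at most
  \<open>m\<close> cover at least \<open>m * n\<close> elements, so no fibre can be smaller.\<close>

lemma fibres_card_eq:
  fixes f :: "'b \<Rightarrow> 'c"
  assumes "finite A" "finite T" "f ` A \<subseteq> T" "m * n \<le> card A" "card T \<le> n"
    and "\<And>t. t \<in> T \<Longrightarrow> card {x \<in> A. f x = t} \<le> m" and "t \<in> T"
  shows "card {x \<in> A. f x = t} = m"
proof (rule ccontr)
  assume "card {x \<in> A. f x = t} \<noteq> m"
  then have lt: "card {x \<in> A. f x = t} < m"
    using assms(6,7) by (simp add: le_neq_trans)
  have "card A = card (\<Union>t\<in>T. {x \<in> A. f x = t})"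
    using assms(3) by (intro arg_cong[of _ _ card]) auto
  also have "\<dots> = (\<Sum>t\<in>T. card {x \<in> A. f x = t})"
    using assms(1,2) by (intro card_UN_disjoint) auto
  also have "\<dots> < (\<Sum>t\<in>T. m)"
    using assms lt by (intro sum_strict_mono_ex1) auto
  also have "\<dots> \<le> m * n"
    using assms(5) by simp
  finally show False
    using assms(4) by simp
qed

lemma card_roots_le:
  fixes f :: "'a::field \<Rightarrow> 'a"
  assumes "\<And>x. poly p x = f x" "degree p = n" "n > 0"
  shows "card {x. f x = 0} \<le> n"
  using card_poly_roots_bound[of p] assms by (metis degree_0 less_irrefl Collect_cong)

section \<open>Trace and norm to the field with \<open>q\<close> elements\<close>

locale hermitian =
  fixes q :: nat and field_type :: "'a::{finite, field} itself"
  assumes q_primepow: "primepow q" and card_field: "CARD('a) = q ^ 2"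
begin

lemma q_gt_1: "q > 1"
  using q_primepow primepow_gt_Suc_0 by simp

text \<open>The characteristic divides \<open>CARD('a)\<close>, a power of \<open>p\<close>, so it
  is \<open>p\<close>, and the power map with exponent \<open>q = p ^ k\<close> is an iterated
  Frobenius map.\<close>

lemma frobenius_add: "(x + y :: 'a) ^ q = x ^ q + y ^ q"
proof -
  obtain p k where pk: "prime p" "k > 0" "q = p ^ k"
    using q_primepow by (auto simp: primepow_def)
  have "prime CHAR('a)"
    by (intro prime_CHAR_semidom finite_imp_CHAR_pos) simp
  moreover have "CHAR('a) dvd p ^ (k * 2)"
    using finite_ring_CHAR_dvd_card[where 'a = 'a] card_field pk by (simp add: power_mult)
  ultimately have "CHAR('a) = p"
    using pk(1) by (metis prime_dvd_power primes_dvd_imp_eq)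
  with \<open>prime CHAR('a)\<close> pk(3) show ?thesis
    by (intro freshmans_dream') auto
qed

lemma frobenius_square: "(x :: 'a) ^ (q * q) = x"
  using finite_field_power_card[of x] card_field by (simp add: power2_eq_square)

lemma frobenius_frobenius: "((x :: 'a) ^ q) ^ q = x"
  using frobenius_square by (simp add: power_mult)

lemma frobenius_diff: "(x - y :: 'a) ^ q = x ^ q - y ^ q"
  using frobenius_add[of "x - y" y] by (simp add: algebra_simps)

definition subfield_q :: "'a set" where "subfield_q = {t. t ^ q = t}"

lemma card_subfield_q_le: "card subfield_q \<le> q"
proof -
  have "degree (monom 1 q + monom (- 1) 1 :: 'a poly) = q"
    using q_gt_1 by (subst degree_add_eq_left) (auto simp: degree_monom_eq)
  then have "card {x :: 'a. x ^ q - x = 0} \<le> q"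
    using q_gt_1 by (intro card_roots_le) (auto simp: poly_monom)
  then show ?thesis
    by (simp add: subfield_q_def)
qed

lemma trace_in_subfield_q: "y ^ q + y \<in> subfield_q"
  by (simp add: subfield_q_def frobenius_add frobenius_frobenius add.commute)

lemma norm_in_subfield_q: "x ^ (q + 1) \<in> subfield_q"
  by (simp add: subfield_q_def power_mult_distrib frobenius_frobenius mult.commute)

text \<open>Each fibre is the root set of a polynomial of degree \<open>q\<close>, and there are at
  most \<open>q\<close> values for \<open>q ^ 2\<close> elements, so the bounds are
  attained.\<close>

lemma card_trace_fibre:
  assumes "t \<in> subfield_q"
  shows "card {y. y ^ q + y = t} = q"
proof -
  have le: "card {y. y ^ q + y = t} \<le> q" for t :: 'a
  proof -
    have "degree (monom 1 q + (monom 1 1 + [:- t:]) :: 'a poly) = q"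
      using q_gt_1
      by (subst degree_add_eq_left) (auto simp: degree_monom_eq degree_add_eq_left)
    then have "card {x. x ^ q + x - t = 0} \<le> q"
      using q_gt_1 by (intro card_roots_le) (auto simp: poly_monom)
    then show ?thesis by simp
  qed
  show ?thesis
    using fibres_card_eq[of UNIV subfield_q "\<lambda>y. y ^ q + y" q q t] le card_subfield_q_le
      trace_in_subfield_q assms card_field
    by (auto simp: power2_eq_square)
qed

text \<open>Root counting gave only an upper bound; equality follows because trace fibres of size
  \<open>q\<close> partition the \<open>q ^ 2\<close> field elements.\<close>

lemma card_subfield_q: "card subfield_q = q"
proof -
  have "(\<Union>t\<in>subfield_q. {y. y ^ q + y = t}) = UNIV"
    using trace_in_subfield_q by blast
  then have "q * q = card (\<Union>t\<in>subfield_q. {y. y ^ q + y = t})"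
    by (simp add: card_field power2_eq_square)
  also have "\<dots> = card subfield_q * q"
    by (subst card_UN_disjoint) (auto simp: card_trace_fibre)
  finally show ?thesis using q_gt_1 by simp
qed

text \<open>The extremal count again, now on nonzero elements: \<open>q - 1\<close> values with
  fibres of size at most \<open>q + 1\<close> for \<open>q ^ 2 - 1\<close> elements.\<close>

lemma card_norm_fibre:
  assumes "t \<in> subfield_q" "t \<noteq> 0"
  shows "card {x. x ^ (q + 1) = t} = q + 1"
proof -
  have le: "card {x. x ^ (q + 1) = t} \<le> q + 1" for t :: 'a
  proof -
    have "degree (monom 1 (q + 1) + [:- t:] :: 'a poly) = q + 1"
      by (subst degree_add_eq_left) (auto simp: degree_monom_eq)
    then have "card {x. x ^ (q + 1) - t = 0} \<le> q + 1"
      by (intro card_roots_le) (auto simp: poly_monom)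
    then show ?thesis by simp
  qed
  have "(q + 1) * (q - 1) = q ^ 2 - 1"
    by (simp add: power2_eq_square algebra_simps)
  then have c: "(q + 1) * (q - 1) \<le> card (UNIV - {0 :: 'a})"
    by (simp add: card_Diff_singleton card_field)
  have z: "0 \<in> subfield_q"
    using q_gt_1 by (simp add: subfield_q_def)
  have "card {x \<in> UNIV - {0}. x ^ (q + 1) = t} = q + 1"
  proof (rule fibres_card_eq[of _ "subfield_q - {0}" _ _ "q - 1"])
    show "(\<lambda>x. x ^ (q + 1)) ` (UNIV - {0}) \<subseteq> subfield_q - {0}"
      using norm_in_subfield_q by auto
    show "card (subfield_q - {0}) \<le> q - 1"
      using z by (simp add: card_Diff_singleton card_subfield_q)
    show "card {x \<in> UNIV - {0}. x ^ (q + 1) = t} \<le> q + 1" for t :: 'a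
      by (rule order_trans[OF card_mono le[of t]]) auto
  qed (use assms c in auto)
  moreover have "{x \<in> UNIV - {0}. x ^ (q + 1) = t} = {x. x ^ (q + 1) = t}"
    using assms(2) by auto
  ultimately show ?thesis by metis
qed

section \<open>Points of the curve on lines\<close>

abbreviation H :: "('a \<times> 'a) set" where "H \<equiv> hermitian_curve q"

lemma hermitian_curve_iff: "P \<in> H \<longleftrightarrow> fst P ^ (q + 1) = snd P ^ q + snd P"
  by (cases P) (simp add: hermitian_curve_def)

lemma card_vertical: "card {P \<in> H. fst P = x} = q"
proof -
  have "{P \<in> H. fst P = x} = Pair x ` {y. y ^ q + y = x ^ (q + 1)}"
    by (auto simp: hermitian_curve_def)
  then show ?thesis
    using card_trace_fibre[OF norm_in_subfield_q[of x]] by (simp add: card_image inj_on_def)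
qed

lemma card_hermitian_curve: "card H = q ^ 3"
proof -
  have "card H = card (\<Union>x\<in>UNIV. {P \<in> H. fst P = x})"
    by (intro arg_cong[of _ _ card]) auto
  also have "\<dots> = (\<Sum>x\<in>UNIV. card {P \<in> H. fst P = x})"
    by (intro card_UN_disjoint) auto
  finally show ?thesis
    by (simp add: card_vertical card_field power2_eq_square power3_eq_cube)
qed

text \<open>Completing the norm: on \<open>y = b x + c\<close> the curve equation reads
  \<open>N (x - b\<^sup>q) = Tr c + N b\<close>, with \<open>N z = z\<^bsup>q+1\<^esup>\<close> and \<open>Tr z = z\<^sup>q + z\<close>.\<close>

lemma line_meets_hermitian_iff:
  "(x, b * x + c) \<in> H \<longleftrightarrow> (x - b ^ q) ^ (q + 1) = c ^ q + c + b ^ (q + 1)"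
proof -
  have "(x - b ^ q) ^ (q + 1) = (x ^ q - b) * (x - b ^ q)"
    by (simp add: frobenius_diff frobenius_frobenius mult.commute)
  moreover have "(b * x + c) ^ q = b ^ q * x ^ q + c ^ q"
    by (simp add: frobenius_add power_mult_distrib)
  ultimately show ?thesis
    by (simp add: hermitian_curve_iff algebra_simps) (auto simp: algebra_simps)
qed

text \<open>The shift by \<open>b ^ q\<close> identifies the intersection with a norm fibre. The
  fibre over 0 is a single point and gives the tangents; all others have \<open>q + 1\<close>
  elements.\<close>

lemma card_nonvertical_line:
  "card {P \<in> H. snd P = b * fst P + c} = (if c ^ q + c + b ^ (q + 1) = 0 then 1 else q + 1)"
proof -
  define t where "t = c ^ q + c + b ^ (q + 1)"
  have t: "t \<in> subfield_q"
    using trace_in_subfield_q[of c] norm_in_subfield_q[of b]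
    by (simp add: t_def subfield_q_def frobenius_add)
  have "{P \<in> H. snd P = b * fst P + c} = (\<lambda>z. (z + b ^ q, b * (z + b ^ q) + c)) ` {z. z ^ (q + 1) = t}"
  proof (intro equalityI subsetI)
    fix P assume "P \<in> {P \<in> H. snd P = b * fst P + c}"
    then have "P = (fst P, b * fst P + c)" "P \<in> H"
      by (auto simp: prod_eq_iff)
    then have "(fst P - b ^ q) ^ (q + 1) = t"
      using line_meets_hermitian_iff t_def by metis
    then show "P \<in> (\<lambda>z. (z + b ^ q, b * (z + b ^ q) + c)) ` {z. z ^ (q + 1) = t}"
      by (intro image_eqI[of _ _ "fst P - b ^ q"]) (use \<open>P = _\<close> in auto)
  next
    fix P assume "P \<in> (\<lambda>z. (z + b ^ q, b * (z + b ^ q) + c)) ` {z. z ^ (q + 1) = t}"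
    then show "P \<in> {P \<in> H. snd P = b * fst P + c}"
      using line_meets_hermitian_iff[of "_ + b ^ q" b c] by (auto simp: t_def)
  qed
  then have "card {P \<in> H. snd P = b * fst P + c} = card {z. z ^ (q + 1) = t}"
    by (simp add: card_image inj_on_def)
  also have "\<dots> = (if t = 0 then 1 else q + 1)"
    using card_norm_fibre[OF t] by (cases "t = 0") (simp_all del: power_Suc add: power_eq_0_iff conj_commute)
  finally show ?thesis by (simp add: t_def)
qed

text \<open>For each of the \<open>q ^ 2\<close> slopes \<open>b\<close>, tangency prescribes the
  trace of \<open>c\<close>, which leaves \<open>q\<close> choices.\<close>

lemma card_tangents: "card {(b :: 'a, c). c ^ q + c + b ^ (q + 1) = 0} = q ^ 3"
proof -
  have "{(b :: 'a, c). c ^ q + c + b ^ (q + 1) = 0} = Sigma UNIV (\<lambda>b. {c. c ^ q + c = - (b ^ (q + 1))})"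
    by (auto simp: add_eq_0_iff2)
  moreover have "- (b ^ (q + 1)) \<in> subfield_q" for b
  proof -
    have "(0 - b ^ (q + 1)) ^ q = 0 - b ^ (q + 1)"
      unfolding frobenius_diff using norm_in_subfield_q[of b] q_gt_1 by (simp add: subfield_q_def)
    then show ?thesis by (simp add: subfield_q_def)
  qed
  ultimately show ?thesis
    by (simp add: card_trace_fibre card_field power2_eq_square power3_eq_cube)
qed

text \<open>The condition \<open>f (Suc 0) = 0\<close> discards the \<open>q ^ 3\<close> tangents
  among the \<open>q ^ 4\<close> non-vertical lines. A general \<open>f\<close> serves the counts of
  four and of exactly three collinear points.\<close>

lemma sum_nonvertical_lines:
  assumes "f (Suc 0) = (0 :: nat)"
  shows "(\<Sum>(b, c)\<in>UNIV. f (card {P \<in> H. snd P = b * fst P + c})) = (q ^ 4 - q ^ 3) * f (q + 1)"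
proof -
  let ?T = "{(b :: 'a, c). c ^ q + c + b ^ (q + 1) = 0}"
  have "(\<Sum>(b, c)\<in>UNIV. f (card {P \<in> H. snd P = b * fst P + c})) =
    (\<Sum>(b, c)\<in>UNIV. if (b, c) \<in> ?T then 0 else f (q + 1))"
    by (intro sum.cong) (auto simp: card_nonvertical_line assms)
  also have "\<dots> = (\<Sum>bc\<in>- ?T. f (q + 1))"
    by (rule sum.mono_neutral_cong_right) (auto split: if_splits)
  also have "\<dots> = (q ^ 4 - q ^ 3) * f (q + 1)"
    using card_tangents
    by (simp add: Compl_eq_Diff_UNIV card_Diff_subset card_field flip: power_mult power_add)
  finally show ?thesis .
qed

end

section \<open>Counting quadruples of points\<close>

lemma sum_two_values:
  assumes "finite F" "A \<subseteq> F" "B \<subseteq> F" "A \<inter> B = {}"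
    and "\<And>x. x \<in> A \<Longrightarrow> f x = u" "\<And>x. x \<in> B \<Longrightarrow> f x = v" "\<And>x. x \<in> F - A - B \<Longrightarrow> f x = 0"
  shows "sum f F = card A * u + card B * (v :: nat)"
proof -
  have "sum f F = sum f (A \<union> B)"
    using assms by (intro sum.mono_neutral_right) auto
  also have "\<dots> = sum f A + sum f B"
    using assms by (intro sum.union_disjoint) (auto intro: finite_subset)
  finally show ?thesis using assms(5,6) by simp
qed

lemma card_subsets_of_blocks:
  assumes "finite I" "\<And>i. i \<in> I \<Longrightarrow> finite (Bl i)"
    and "\<And>i j S. i \<in> I \<Longrightarrow> j \<in> I \<Longrightarrow> card S = k \<Longrightarrow> S \<subseteq> Bl i \<Longrightarrow> S \<subseteq> Bl j \<Longrightarrow> i = j"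
  shows "card {S. card S = k \<and> (\<exists>i\<in>I. S \<subseteq> Bl i)} = (\<Sum>i\<in>I. card (Bl i) choose k)"
proof -
  have "{S. card S = k \<and> (\<exists>i\<in>I. S \<subseteq> Bl i)} = (\<Union>i\<in>I. {S. S \<subseteq> Bl i \<and> card S = k})"
    by auto
  also have "card \<dots> = (\<Sum>i\<in>I. card {S. S \<subseteq> Bl i \<and> card S = k})"
    using assms by (intro card_UN_disjoint) fastforce+
  also have "\<dots> = (\<Sum>i\<in>I. card (Bl i) choose k)"
    using assms(2) by (intro sum.cong refl n_subsets)
  finally show ?thesis .
qed

text \<open>Two subsets with at least 3 elements inside a set of at most 4 share at least
  \<open>3 + 3 - 4 = 2\<close> elements.\<close>

lemma common_points_of_three_point_traces:
  assumes "card S \<le> 4" "finite S" "card (S \<inter> A) \<ge> 3" "card (S \<inter> B) \<ge> 3"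
  shows "\<exists>P Q. P \<noteq> Q \<and> {P, Q} \<subseteq> A \<inter> B"
proof -
  have "card (S \<inter> A) + card (S \<inter> B) = card (S \<inter> A \<union> S \<inter> B) + card (S \<inter> A \<inter> (S \<inter> B))"
    using assms(2) by (intro card_Un_Int) auto
  moreover have "card (S \<inter> A \<union> S \<inter> B) \<le> card S"
    using assms(2) by (intro card_mono) auto
  ultimately have "card (S \<inter> A \<inter> (S \<inter> B)) \<ge> 2"
    using assms by simp
  then obtain T where "T \<subseteq> S \<inter> A \<inter> (S \<inter> B)" "card T = 2"
    by (meson obtain_subset_with_card_n)
  then show ?thesis
    unfolding card_2_iff by blast
qed

text \<open>Choose a triple inside a block and the fourth point outside it. The block is unique,
  since two such blocks would share two points.\<close>

lemma card_sets_with_three_in_block: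
  assumes "finite I" "finite X" "\<And>i. i \<in> I \<Longrightarrow> Bl i \<subseteq> X"
    and "\<And>i j P Q. i \<in> I \<Longrightarrow> j \<in> I \<Longrightarrow> P \<noteq> Q \<Longrightarrow> {P, Q} \<subseteq> Bl i \<inter> Bl j \<Longrightarrow> i = j"
  shows "card {S. S \<subseteq> X \<and> card S = 4 \<and> (\<exists>i\<in>I. card (S \<inter> Bl i) = 3)} =
    (\<Sum>i\<in>I. (card (Bl i) choose 3) * (card X - card (Bl i)))"
proof -
  let ?A = "\<lambda>i. {S. S \<subseteq> X \<and> card S = 4 \<and> card (S \<inter> Bl i) = 3}"
  have "{S. S \<subseteq> X \<and> card S = 4 \<and> (\<exists>i\<in>I. card (S \<inter> Bl i) = 3)} = (\<Union>i\<in>I. ?A i)"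
    by auto
  also have "card \<dots> = (\<Sum>i\<in>I. card (?A i))"
  proof (rule card_UN_disjoint)
    show "\<forall>i\<in>I. finite (?A i)"
      using assms(2) by simp
    show "\<forall>i\<in>I. \<forall>j\<in>I. i \<noteq> j \<longrightarrow> ?A i \<inter> ?A j = {}"
    proof (intro ballI impI, rule ccontr)
      fix i j assume ij: "i \<in> I" "j \<in> I" "i \<noteq> j" "?A i \<inter> ?A j \<noteq> {}"
      then obtain S where "S \<subseteq> X" "card S = 4" "card (S \<inter> Bl i) = 3" "card (S \<inter> Bl j) = 3"
        by auto
      then have "\<exists>P Q. P \<noteq> Q \<and> {P, Q} \<subseteq> Bl i \<inter> Bl j"
        using assms(2) by (intro common_points_of_three_point_traces[of S]) (auto intro: finite_subset)
      then show False using assms(4) ij by blast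
    qed
  qed (use assms in auto)
  also have "\<dots> = (\<Sum>i\<in>I. (card (Bl i) choose 3) * (card X - card (Bl i)))"
  proof (intro sum.cong refl)
    fix i assume "i \<in> I"
    then have sub: "Bl i \<subseteq> X" by (rule assms(3))
    then have fin: "finite (Bl i)" using assms(2) by (rule finite_subset)
    let ?T = "{T. T \<subseteq> Bl i \<and> card T = 3} \<times> (X - Bl i)"
    have "bij_betw (\<lambda>(T, P). insert P T) ?T (?A i)"
      unfolding bij_betw_def
    proof
      \<comment> \<open>The chosen triple and the extra point are recovered as intersection with and
        difference from the block.\<close>
      have "T = insert P T \<inter> Bl i \<and> {P} = insert P T - Bl i" if "(T, P) \<in> ?T" for T P
        using that by auto
      then show "inj_on (\<lambda>(T, P). insert P T) ?T"
        by (intro inj_onI) (metis (mono_tags, lifting) case_prod_conv singleton_inject surj_pair)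
      show "(\<lambda>(T, P). insert P T) ` ?T = ?A i"
      proof (intro equalityI subsetI)
        fix S assume "S \<in> (\<lambda>(T, P). insert P T) ` ?T"
        then obtain T P where TP: "S = insert P T" "T \<subseteq> Bl i" "card T = 3" "P \<in> X - Bl i"
          by auto
        then have "S \<inter> Bl i = T" "P \<notin> T" "finite T"
          using fin by (auto intro: finite_subset)
        then show "S \<in> ?A i"
          using TP sub by auto
      next
        fix S assume S: "S \<in> ?A i"
        then have finS: "finite S" using assms(2) by (auto intro: finite_subset)
        have "card (S - Bl i) = card S - card (S \<inter> Bl i)"
          using finS by (intro card_Diff_subset_Int) auto
        then have "card (S - Bl i) = 1" using S by simp
        then obtain P where P: "S - Bl i = {P}" by (auto simp: card_1_singleton_iff)
        then have "S = insert P (S \<inter> Bl i)" "P \<in> X - Bl i" using S by auto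
        then show "S \<in> (\<lambda>(T, P). insert P T) ` ?T"
          using S by (intro image_eqI[of _ _ "(S \<inter> Bl i, P)"]) auto
      qed
    qed
    from bij_betw_same_card[OF this]
    show "card (?A i) = (card (Bl i) choose 3) * (card X - card (Bl i))"
      using n_subsets[OF fin, of 3] sub fin by (simp add: card_cartesian_product card_Diff_subset)
  qed
  finally show ?thesis .
qed

lemma sum_UNIV_sum:
  fixes f :: "'b::finite + 'c::finite \<Rightarrow> 'd::comm_monoid_add"
  shows "sum f UNIV = (\<Sum>x\<in>UNIV. f (Inl x)) + (\<Sum>y\<in>UNIV. f (Inr y))"
  by (simp add: sum.Plus flip: UNIV_Plus_UNIV)

section \<open>Quadruples on the curve by geometric type\<close>

context hermitian
begin

lemma sum_lines:
  assumes "f (Suc 0) = (0 :: nat)"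
  shows "(\<Sum>i\<in>UNIV. f (card (H \<inter> line i))) = q ^ 2 * f q + (q ^ 4 - q ^ 3) * f (q + 1)"
proof -
  have "H \<inter> line (Inl x) = {P \<in> H. fst P = x}" for x by auto
  then have "(\<Sum>x\<in>UNIV. f (card (H \<inter> line (Inl x)))) = q ^ 2 * f q"
    by (simp add: card_vertical card_field)
  moreover have "H \<inter> line (Inr (b, c)) = {P \<in> H. snd P = b * fst P + c}" for b c by auto
  then have "(\<Sum>bc\<in>UNIV. f (card (H \<inter> line (Inr bc)))) =
    (\<Sum>(b, c)\<in>UNIV. f (card {P \<in> H. snd P = b * fst P + c}))"
    by (intro sum.cong refl) (simp only: split_paired_all case_prod_conv)
  then have "(\<Sum>bc\<in>UNIV. f (card (H \<inter> line (Inr bc)))) = (q ^ 4 - q ^ 3) * f (q + 1)"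
    using sum_nonvertical_lines[of f, OF assms] by simp
  ultimately show ?thesis
    by (simp only: sum_UNIV_sum)
qed

abbreviation quadruples :: "('a \<times> 'a) set set" where
  "quadruples \<equiv> {S. S \<subseteq> H \<and> card S = 4}"

lemma card_quadruples_on_lines:
  "card {S \<in> quadruples. \<exists>i. S \<subseteq> line i} = q ^ 2 * (q choose 4) + (q ^ 4 - q ^ 3) * (q + 1 choose 4)"
proof -
  have "card {S. card S = 4 \<and> (\<exists>i\<in>UNIV. S \<subseteq> H \<inter> line i)} = (\<Sum>i\<in>UNIV. card (H \<inter> line i) choose 4)"
  proof (rule card_subsets_of_blocks)
    fix i j S assume "card S = 4" "S \<subseteq> H \<inter> line i" "S \<subseteq> H \<inter> line j"
    moreover obtain P Q R T where "S = {P, Q, R, T}" "distinct [P, Q, R, T]"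
      using card_four_elementE[OF \<open>card S = 4\<close>] .
    ultimately show "i = j" using line_unique[of P i Q j] by auto
  qed auto
  moreover have "{S \<in> quadruples. \<exists>i. S \<subseteq> line i} = {S. card S = 4 \<and> (\<exists>i\<in>UNIV. S \<subseteq> H \<inter> line i)}"
    by auto
  ultimately show ?thesis
    using sum_lines[of "\<lambda>k. k choose 4"] by simp
qed

lemma card_quadruples_vertical: "card {S \<in> quadruples. \<exists>x. S \<subseteq> line (Inl x)} = q ^ 2 * (q choose 4)"
proof -
  have "card {S. card S = 4 \<and> (\<exists>x\<in>UNIV. S \<subseteq> H \<inter> line (Inl x))} =
    (\<Sum>x\<in>UNIV. card (H \<inter> line (Inl x)) choose 4)"
  proof (rule card_subsets_of_blocks)
    fix i j :: 'a and S assume "card S = 4" "S \<subseteq> H \<inter> line (Inl i)" "S \<subseteq> H \<inter> line (Inl j)"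
    moreover from this have "S \<noteq> {}" by auto
    ultimately show "i = j" by auto
  qed auto
  moreover have "H \<inter> line (Inl x) = {P \<in> H. fst P = x}" for x by auto
  moreover have "{S \<in> quadruples. \<exists>x. S \<subseteq> line (Inl x)} =
    {S. card S = 4 \<and> (\<exists>x\<in>UNIV. S \<subseteq> H \<inter> line (Inl x))}"
    by auto
  ultimately show ?thesis
    by (simp only: card_vertical card_field sum_constant of_nat_id)
qed

lemma vertical_nonvertical_disjoint:
  "{S \<in> quadruples. \<exists>x. S \<subseteq> line (Inl x)} \<inter> {S \<in> quadruples. \<exists>bc. S \<subseteq> line (Inr bc)} = {}"
proof (rule equals0I)
  fix S
  assume "S \<in> {S \<in> quadruples. \<exists>x. S \<subseteq> line (Inl x)} \<inter> {S \<in> quadruples. \<exists>bc. S \<subseteq> line (Inr bc)}"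
  then obtain x bc where S: "card S = 4" "S \<subseteq> line (Inl x)" "S \<subseteq> line (Inr bc)"
    by (simp del: line.simps) blast
  obtain P Q R T where "S = {P, Q, R, T}" "distinct [P, Q, R, T]"
    using card_four_elementE[OF S(1)] .
  then show False using S line_unique[of P "Inl x" Q "Inr bc"] by (simp del: line.simps)
qed

lemma card_quadruples_nonvertical:
  "card {S \<in> quadruples. \<exists>bc. S \<subseteq> line (Inr bc)} = (q ^ 4 - q ^ 3) * (q + 1 choose 4)"
proof -
  have eq: "{S \<in> quadruples. \<exists>i. S \<subseteq> line i} =
    {S \<in> quadruples. \<exists>x. S \<subseteq> line (Inl x)} \<union> {S \<in> quadruples. \<exists>bc. S \<subseteq> line (Inr bc)}"
    unfolding split_sum_ex by blast
  have "card {S \<in> quadruples. \<exists>i. S \<subseteq> line i} =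
    card {S \<in> quadruples. \<exists>x. S \<subseteq> line (Inl x)} + card {S \<in> quadruples. \<exists>bc. S \<subseteq> line (Inr bc)}"
    unfolding eq using vertical_nonvertical_disjoint by (intro card_Un_disjoint) auto
  then show ?thesis
    using card_quadruples_on_lines card_quadruples_vertical by simp
qed

lemma card_quadruples_three_collinear:
  "card {S \<in> quadruples. \<exists>i. card (S \<inter> line i) = 3} =
    q ^ 2 * ((q choose 3) * (q ^ 3 - q)) + (q ^ 4 - q ^ 3) * ((q + 1 choose 3) * (q ^ 3 - (q + 1)))"
proof -
  have "card {S. S \<subseteq> H \<and> card S = 4 \<and> (\<exists>i\<in>UNIV. card (S \<inter> (H \<inter> line i)) = 3)} =
    (\<Sum>i\<in>UNIV. (card (H \<inter> line i) choose 3) * (card H - card (H \<inter> line i)))"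
    by (rule card_sets_with_three_in_block) (auto intro: line_unique)
  moreover have "{S. S \<subseteq> H \<and> card S = 4 \<and> (\<exists>i\<in>UNIV. card (S \<inter> (H \<inter> line i)) = 3)} =
    {S \<in> quadruples. \<exists>i. card (S \<inter> line i) = 3}"
    by (auto simp: Int_absorb2 simp flip: Int_assoc)
  ultimately show ?thesis
    using sum_lines[of "\<lambda>k. (k choose 3) * (q ^ 3 - k)"] by (simp add: card_hermitian_curve)
qed

text \<open>Choose two of the \<open>q ^ 2\<close> abscissae and then two of the \<open>q\<close>
  curve points above each. The bijection sends \<open>S\<close> to its abscissae with its vertical
  slices; its inverse is the union of the slices.\<close>

lemma card_two_vertical_pairs:
  "card {S. S \<subseteq> H \<and> two_vertical_pairs S} = (q ^ 2 choose 2) * (q choose 2) ^ 2"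
proof -
  let ?V = "\<lambda>x. {T. T \<subseteq> {P \<in> H. fst P = x} \<and> card T = 2}"
  let ?XG = "Sigma {X. card X = 2} (\<lambda>X. Pi\<^sub>E X ?V)"
  let ?f = "\<lambda>S. (fst ` S, restrict (\<lambda>x. {P \<in> S. fst P = x}) (fst ` S))"
  have "bij_betw ?f {S. S \<subseteq> H \<and> two_vertical_pairs S} ?XG"
  proof (rule bij_betwI[where g = "\<lambda>(X, g). \<Union>x\<in>X. g x"])
    show "?f \<in> {S. S \<subseteq> H \<and> two_vertical_pairs S} \<rightarrow> ?XG"
    proof
      fix S assume S: "S \<in> {S. S \<subseteq> H \<and> two_vertical_pairs S}"
      then have "restrict (\<lambda>x. {P \<in> S. fst P = x}) (fst ` S) \<in> Pi\<^sub>E (fst ` S) ?V"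
        unfolding two_vertical_pairs_def by (intro restrict_PiE_iff[THEN iffD2]) blast
      then show "?f S \<in> ?XG"
        using S by (simp add: two_vertical_pairs_def)
    qed
    have slices: "fst ` (\<Union>x\<in>X. g x) = X \<and> (\<forall>x\<in>X. {P \<in> \<Union>x\<in>X. g x. fst P = x} = g x)"
      if "(X, g) \<in> ?XG" for X g
    proof -
      have g: "g x \<subseteq> {P \<in> H. fst P = x}" "g x \<noteq> {}" if "x \<in> X" for x
        using \<open>(X, g) \<in> ?XG\<close> that by (auto simp: PiE_iff)
      show ?thesis
      proof (intro conjI ballI equalityI subsetI)
        fix x assume "x \<in> X"
        then obtain P where "P \<in> g x" "fst P = x" using g by blast
        then show "x \<in> fst ` (\<Union>x\<in>X. g x)" using \<open>x \<in> X\<close> by blast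
      qed (use g in blast)+
    qed
    show "(\<lambda>(X, g). \<Union>x\<in>X. g x) \<in> ?XG \<rightarrow> {S. S \<subseteq> H \<and> two_vertical_pairs S}"
    proof
      fix z assume z: "z \<in> ?XG"
      obtain X g where [simp]: "z = (X, g)" by (cases z)
      have "(\<Union>x\<in>X. g x) \<subseteq> H" using z by (auto simp: PiE_iff)
      moreover have "two_vertical_pairs (\<Union>x\<in>X. g x)"
        unfolding two_vertical_pairs_def using slices[of X g] z by (auto simp: PiE_iff)
      ultimately show "(\<lambda>(X, g). \<Union>x\<in>X. g x) z \<in> {S. S \<subseteq> H \<and> two_vertical_pairs S}"
        by simp
    qed
    show "(\<lambda>(X, g). \<Union>x\<in>X. g x) (?f S) = S" for S
      by auto
    show "?f ((\<lambda>(X, g). \<Union>x\<in>X. g x) z) = z" if "z \<in> ?XG" for z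
    proof -
      obtain X g where [simp]: "z = (X, g)" by (cases z)
      have s: "fst ` (\<Union>x\<in>X. g x) = X" "\<And>x. x \<in> X \<Longrightarrow> {P \<in> \<Union>x\<in>X. g x. fst P = x} = g x"
        using slices[of X g] that by auto
      have "restrict (\<lambda>x. {P \<in> \<Union>x\<in>X. g x. fst P = x}) X = restrict g X"
        using s(2) by (intro restrict_ext) auto
      also have "\<dots> = g" using that by (auto simp: PiE_iff extensional_restrict)
      finally show ?thesis using s(1) by simp
    qed
  qed
  then have "card {S. S \<subseteq> H \<and> two_vertical_pairs S} = card ?XG"
    by (rule bij_betw_same_card)
  also have "\<dots> = (\<Sum>X\<in>{X :: 'a set. card X = 2}. \<Prod>x\<in>X. card (?V x))"
    by (subst card_SigmaI) (auto intro!: finite_PiE sum.cong card_PiE)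
  also have "\<dots> = (\<Sum>X\<in>{X :: 'a set. card X = 2}. (q choose 2) ^ 2)"
    by (intro sum.cong refl) (simp add: n_subsets card_vertical)
  also have "\<dots> = (q ^ 2 choose 2) * (q choose 2) ^ 2"
    using n_subsets[of "UNIV :: 'a set" 2] by (simp add: card_field)
  finally show ?thesis .
qed

text \<open>Substituting the curve into the Hermitian equation gives a polynomial in
  \<open>x\<close> of degree \<open>2 * q\<close> when \<open>a\<close> is nonzero. For a line the
  bound is \<open>q + 1\<close>, at most \<open>2 * q\<close>.\<close>

lemma card_curve_le:
  "card (quadratic_curve a b c \<inter> H) \<le> 2 * q"
proof (cases "a = 0")
  case True
  then have "quadratic_curve a b c \<inter> H = {P \<in> H. snd P = b * fst P + c}"
    by (auto simp: quadratic_curve_iff)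
  then show ?thesis
    using card_nonvertical_line[of b c] q_gt_1 by (auto split: if_splits)
next
  case False
  let ?g = "[:c, b, a:]"
  \<comment> \<open>The \<open>q\<close>-th power is split off because it alone reaches degree
    \<open>2 * q\<close>, which exceeds both 2 and \<open>q + 1\<close>.\<close>
  let ?p = "?g ^ q + (?g - monom 1 (q + 1))"
  have "degree (?g - monom 1 (q + 1)) \<le> max 2 (q + 1)"
    using degree_diff_le_max[of ?g "monom 1 (q + 1)"] False by (simp add: degree_monom_eq)
  moreover have "degree (?g ^ q) = 2 * q"
    using False by (simp add: degree_power_eq)
  ultimately have "degree ?p = 2 * q"
    using q_gt_1 by (subst degree_add_eq_left) auto
  then have "card {x. (c + b * x + a * x ^ 2) ^ q + (c + b * x + a * x ^ 2) - x ^ (q + 1) = 0} \<le> 2 * q"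
    using q_gt_1 by (intro card_roots_le[of ?p]) (auto simp: poly_monom algebra_simps power2_eq_square)
  moreover have "card (quadratic_curve a b c \<inter> H) \<le>
    card {x. (c + b * x + a * x ^ 2) ^ q + (c + b * x + a * x ^ 2) - x ^ (q + 1) = 0}"
  proof (rule card_inj_on_le[of fst])
    show "inj_on fst (quadratic_curve a b c \<inter> H)"
      by (rule quadratic_curve_inj_on_fst) auto
  qed (auto simp: quadratic_curve_iff hermitian_curve_iff add_ac simp del: power_Suc)
  ultimately show ?thesis by linarith
qed

lemma card_quadruples_on_curves:
  "card {S \<in> quadruples. \<exists>a b c. S \<subseteq> quadratic_curve a b c} =
    (\<Sum>k = 4..2 * q. num_curves_meeting TYPE('a) q k * (k choose 4))"
proof -
  let ?C = "parabolas \<union> non_vertical_lines :: ('a \<times> 'a) set set"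
  have "card {S. card S = 4 \<and> (\<exists>C\<in>?C. S \<subseteq> C \<inter> H)} = (\<Sum>C\<in>?C. card (C \<inter> H) choose 4)"
  proof (rule card_subsets_of_blocks)
    fix C D S assume "C \<in> ?C" "D \<in> ?C" "card S = 4" "S \<subseteq> C \<inter> H" "S \<subseteq> D \<inter> H"
    then show "C = D"
      using quadratic_curve_unique[of S] unfolding parabolas_Un_lines_eq by blast
  qed auto
  also have "{S. card S = 4 \<and> (\<exists>C\<in>?C. S \<subseteq> C \<inter> H)} =
      {S \<in> quadruples. \<exists>a b c. S \<subseteq> quadratic_curve a b c}"
    unfolding parabolas_Un_lines_eq by blast
  \<comment> \<open>Group the curves by their number \<open>k\<close> of points on \<open>H\<close>;
    the terms with \<open>k < 4\<close> drop out afterwards because their binomial coefficient is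
    0.\<close>
  also have "(\<Sum>C\<in>?C. card (C \<inter> H) choose 4) =
    (\<Sum>k = 0..2 * q. \<Sum>C\<in>{C \<in> ?C. card (C \<inter> H) = k}. card (C \<inter> H) choose 4)"
    by (rule sum.group[symmetric]) (auto simp: parabolas_Un_lines_eq card_curve_le)
  also have "\<dots> = (\<Sum>k = 0..2 * q. num_curves_meeting TYPE('a) q k * (k choose 4))"
    by (intro sum.cong refl) (simp add: num_curves_meeting_def)
  also have "\<dots> = (\<Sum>k = 4..2 * q. num_curves_meeting TYPE('a) q k * (k choose 4))"
    by (rule sum.mono_neutral_right) auto
  finally show ?thesis .
qed

section \<open>The weight-4 counts in terms of quadruples\<close>

lemma card_field_minus: "CARD('a) - 1 = q ^ 2 - 1" "CARD('a) - 3 = q ^ 2 - 3"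
  by (simp_all add: card_field)

lemma card_quadruples: "card quadruples = q ^ 3 choose 4"
  using n_subsets[of H 4] by (simp add: card_hermitian_curve)

text \<open>\<open>g\<close> is the number of quadruples without three collinear points.\<close>

lemma num_words_H0:
  "\<exists>g. num_words q (corner_code_H0 q :: ('a \<times> 'a \<Rightarrow> 'a) set) 4 =
      card {S \<in> quadruples. \<exists>i. S \<subseteq> line i} * ((q ^ 2 - 1) * (q ^ 2 - 3)) + g * (q ^ 2 - 1)
    \<and> g + card {S \<in> quadruples. \<exists>i. S \<subseteq> line i} + card {S \<in> quadruples. \<exists>i. card (S \<inter> line i) = 3}
      = q ^ 3 choose 4"
proof (intro exI conjI)
  let ?A = "{S \<in> quadruples. \<exists>i. S \<subseteq> line i}"
  let ?C = "{S \<in> quadruples. \<exists>i. card (S \<inter> line i) = 3}"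
  have disj: "?A \<inter> ?C = {}"
  proof (rule equals0I)
    fix S assume S: "S \<in> ?A \<inter> ?C"
    then obtain i j where ij: "S \<subseteq> line i" "card (S \<inter> line j) = 3" by blast
    then have *: "S \<inter> line i = S" by blast
    \<comment> \<open>All four points on one line and three on another would give two common points,
      so the lines coincide and \<open>4 = 3\<close>.\<close>
    have "\<exists>P Q. P \<noteq> Q \<and> {P, Q} \<subseteq> line i \<inter> line j"
      using S ij by (intro common_points_of_three_point_traces[of S]) (auto simp: * simp del: line.simps)
    then have "i = j" by (blast intro: line_unique)
    then show False using S * ij by simp
  qed
  have "card (quadruples - ?A - ?C) = card quadruples - card ?A - card ?C"
    using disj by (subst card_Diff_subset, simp, blast)+ simp
  \<comment> \<open>This bound makes the truncated subtractions above genuine.\<close>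
  moreover have "card ?A + card ?C \<le> card quadruples"
    using disj by (subst card_Un_disjoint[symmetric]) (auto intro!: card_mono)
  ultimately show "card (quadruples - ?A - ?C) + card ?A + card ?C = q ^ 3 choose 4"
    using card_quadruples by simp
  show "num_words q (corner_code_H0 q :: ('a \<times> 'a \<Rightarrow> 'a) set) 4 =
      card ?A * ((q ^ 2 - 1) * (q ^ 2 - 3)) + card (quadruples - ?A - ?C) * (q ^ 2 - 1)"
    unfolding corner_code_H0_def num_words_eq_sum
  proof (rule sum_two_values)
    fix S assume "S \<in> ?A"
    then show "card (full_words checks_H0 S) = (q ^ 2 - 1) * (q ^ 2 - 3)"
      using card_full_words_H0_line[of S] card_field_minus by auto
  next
    fix S assume S: "S \<in> quadruples - ?A - ?C"
    then have fin: "finite S" by simp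
    have "card (S \<inter> line i) \<le> 2" for i
    proof -
      have "card (S \<inter> line i) \<noteq> 3" "\<not> S \<subseteq> line i" "card S = 4" using S by blast+
      moreover from this(2) have "card (S \<inter> line i) < card S"
        using fin by (intro psubset_card_mono) auto
      ultimately show ?thesis by linarith
    qed
    then show "card (full_words checks_H0 S) = q ^ 2 - 1"
      using card_full_words_H0_general[of S] S card_field_minus by simp
  next
    fix S assume "S \<in> quadruples - ?A - (quadruples - ?A - ?C)"
    then obtain i where "card S = 4" "card (S \<inter> line i) = 3" "\<not> S \<subseteq> line i"
      by blast
    then show "card (full_words checks_H0 S) = 0"
      using full_words_H0_empty[of S i] by simp
  qed auto
qed

text \<open>The number of distinct abscissae separates the classes of supports: 1 on a vertical
  line, 4 on a quadratic curve, 2 for two vertical pairs.\<close>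

lemma num_words_H1:
  "num_words q (edge_code_H1 q :: ('a \<times> 'a \<Rightarrow> 'a) set) 4 =
    card {S \<in> quadruples. \<exists>x. S \<subseteq> line (Inl x)} * ((q ^ 2 - 1) * (q ^ 2 - 3))
    + (card {S \<in> quadruples. \<exists>a b c. S \<subseteq> quadratic_curve a b c}
       + card {S. S \<subseteq> H \<and> two_vertical_pairs S}) * (q ^ 2 - 1)"
proof -
  let ?A = "{S \<in> quadruples. \<exists>x. S \<subseteq> line (Inl x)}"
  let ?B = "{S \<in> quadruples. \<exists>a b c. S \<subseteq> quadratic_curve a b c}"
  let ?C = "{S. S \<subseteq> H \<and> two_vertical_pairs S}"
  have pair: "\<not> inj_on fst S \<and> card S = 4" if two: "two_vertical_pairs S" for S :: "('a \<times> 'a) set"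
  proof -
    obtain P1 P2 P3 P4 where "S = {P1, P2, P3, P4}" "distinct [P1, P2, P3, P4]" "fst P1 = fst P2"
      using two by (rule two_vertical_pairsE)
    then show ?thesis by (auto simp: inj_on_def)
  qed
  have BC: "?B \<inter> ?C = {}"
    using pair quadratic_curve_inj_on_fst by blast
  have "?A \<inter> ?B = {}"
  proof (rule equals0I)
    fix S assume S: "S \<in> ?A \<inter> ?B"
    then obtain x where x: "S \<subseteq> line (Inl x)" by blast
    have "inj_on fst S" using S quadratic_curve_inj_on_fst by blast
    then have "card (fst ` S) = 4" using S by (simp add: card_image)
    moreover have "fst ` S \<subseteq> {x}" using x by auto
    ultimately show False using card_mono[of "{x}" "fst ` S"] by simp
  qed
  moreover have "?A \<inter> ?C = {}"
  proof (rule equals0I)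
    fix S assume S: "S \<in> ?A \<inter> ?C"
    then obtain x where x: "S \<subseteq> line (Inl x)" by blast
    have "card (fst ` S) = 2" using S by (simp add: two_vertical_pairs_def)
    moreover have "fst ` S \<subseteq> {x}" using x by auto
    ultimately show False using card_mono[of "{x}" "fst ` S"] by simp
  qed
  ultimately have disj: "?A \<inter> (?B \<union> ?C) = {}" by blast
  have "num_words q (edge_code_H1 q :: ('a \<times> 'a \<Rightarrow> 'a) set) 4 =
    card ?A * ((q ^ 2 - 1) * (q ^ 2 - 3)) + card (?B \<union> ?C) * (q ^ 2 - 1)"
    unfolding edge_code_H1_def num_words_eq_sum
  proof (rule sum_two_values)
    show "?B \<union> ?C \<subseteq> quadruples" using pair by blast
    show "card (full_words checks_H1 S) = (q ^ 2 - 1) * (q ^ 2 - 3)" if "S \<in> ?A" for S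
      using card_full_words_vertical(2)[of S] that card_field_minus by auto
    show "card (full_words checks_H1 S) = q ^ 2 - 1" if "S \<in> ?B \<union> ?C" for S
    proof (cases "S \<in> ?B")
      case True
      then show ?thesis using card_full_words_H1_curve[of S] card_field_minus by auto
    next
      case False
      then have "two_vertical_pairs S" using that by blast
      then obtain P1 P2 P3 P4 where "S = {P1, P2, P3, P4}" "distinct [P1, P2, P3, P4]"
        "fst P1 = fst P2" "fst P3 = fst P4" "fst P1 \<noteq> fst P3"
        by (rule two_vertical_pairsE)
      then show ?thesis
        using card_words_two_vertical_pairs[of P1 P2 P3 P4 S] card_field_minus
        unfolding full_words_H1 by simp
    qed
    show "card (full_words checks_H1 S) = 0" if "S \<in> quadruples - ?A - (?B \<union> ?C)" for S
    proof -
      have "full_words checks_H1 S = {}"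
        using full_words_H1_cases[of S] that by blast
      then show ?thesis by simp
    qed
  qed (use disj in auto)
  moreover have "card (?B \<union> ?C) = card ?B + card ?C"
    using BC by (intro card_Un_disjoint) auto
  ultimately show ?thesis by simp
qed

lemma num_words_H2:
  "num_words q (edge_code_H2 q :: ('a \<times> 'a \<Rightarrow> 'a) set) 4 =
    card {S \<in> quadruples. \<exists>x. S \<subseteq> line (Inl x)} * ((q ^ 2 - 1) * (q ^ 2 - 3))
    + card {S \<in> quadruples. \<exists>bc. S \<subseteq> line (Inr bc)} * (q ^ 2 - 1)"
  unfolding edge_code_H2_def num_words_eq_sum
proof (rule sum_two_values)
  let ?A = "{S \<in> quadruples. \<exists>x. S \<subseteq> line (Inl x)}"
  let ?B = "{S \<in> quadruples. \<exists>bc. S \<subseteq> line (Inr bc)}"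
  show "?A \<inter> ?B = {}" by (rule vertical_nonvertical_disjoint)
  show "card (full_words checks_H2 S) = (q ^ 2 - 1) * (q ^ 2 - 3)" if "S \<in> ?A" for S
    using card_full_words_vertical(3)[of S] that card_field_minus by auto
  show "card (full_words checks_H2 S) = q ^ 2 - 1" if "S \<in> ?B" for S
    using card_full_words_H2_line[of S] that card_field_minus by (simp del: line.simps) blast
  show "card (full_words checks_H2 S) = 0" if "S \<in> quadruples - ?A - ?B" for S
  proof -
    have "full_words checks_H2 S = {}"
      using full_words_H2_cases[of S] that by blast
    then show ?thesis by simp
  qed
qed auto

end

section \<open>Evaluation of the counts as expressions in \<open>q\<close>\<close>

lemma of_nat_choose_2: "real (n choose 2) = real n * (real n - 1) / 2"
  by (simp add: binomial_gbinomial gbinomial_prod_rev numeral_eq_Suc field_simps)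

lemma of_nat_choose_4: "real (n choose 4) = real (n choose 3) * (real n - 3) / 4"
  by (simp add: binomial_gbinomial gbinomial_prod_rev numeral_eq_Suc field_simps)

lemma of_nat_choose_3_Suc: "(real n + 1) * real (n choose 3) = (real n - 2) * real (n + 1 choose 3)"
  by (simp add: binomial_gbinomial gbinomial_prod_rev numeral_eq_Suc field_simps)

theorem theorem4p13:
  fixes q :: nat
  assumes "primepow q" and "q \<ge> 3"
    and "CARD('a::{finite,field}) = q ^ 2"
  shows
    "real (num_words q (corner_code_H0 q :: ('a \<times> 'a \<Rightarrow> 'a) set) 4) =
       1 / 4 * (real (q ^ 3 choose 3) * (real q + 1)
                - real q ^ 2 * real ((q + 1) choose 3) * (3 * real q ^ 3 + 2 * real q ^ 2 - 8))
         * (real q - 1) * (real q ^ 3 - 3)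
     \<and> real (num_words q (edge_code_H1 q :: ('a \<times> 'a \<Rightarrow> 'a) set) 4) =
       real q ^ 2 * real (q choose 4) * (real q ^ 4 - 4 * real q ^ 2 + 3)
         + real q ^ 4 * (real q ^ 2 - 1) ^ 2 * (real q - 1) ^ 2 / 8
         + (real q ^ 2 - 1)
             * (\<Sum>k = 4..2 * q. real (num_curves_meeting TYPE('a) q k) * real (k choose 4))
     \<and> real (num_words q (edge_code_H2 q :: ('a \<times> 'a \<Rightarrow> 'a) set) 4) =
       real q ^ 2 * (real q - 1) * real ((q + 1) choose 4)
         * (2 * real q ^ 3 - 3 * real q ^ 2 - 4 * real q + 9)"
proof -
  interpret hermitian q "TYPE('a)"
    using assms by unfold_locales
  define r where "r = real q"
  \<comment> \<open>\<open>Y\<close> equals \<open>q (q - 1) / 6\<close>; the binomials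
    \<open>q\<close> or \<open>q + 1\<close> over 3 or 4 are polynomial multiples of it, so the
    identities become polynomial in \<open>r\<close> and linear in \<open>Y\<close>.\<close>
  define Y where "Y = real (q + 1 choose 3) / (r + 1)"
  have r: "r \<ge> 3" using assms(2) by (simp add: r_def)
  \<comment> \<open>These inequalities turn the natural-number differences into real ones;
    \<open>3 \<le> q ^ 2\<close> and the others use the bound \<open>q \<ge> 3\<close>.\<close>
  have le: "q \<le> q ^ 3" "q + 1 \<le> q ^ 3" "q ^ 3 \<le> q ^ 4" "1 \<le> q ^ 2" "3 \<le> q ^ 2"
  proof -
    have "q * 3 \<le> q * q" using assms(2) by simp
    then have "q ^ 2 \<ge> 3 * q" by (simp add: power2_eq_square)
    moreover have "q ^ 2 \<le> q ^ 3" "q ^ 3 \<le> q ^ 4" using assms(2) by (auto intro: power_increasing)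
    ultimately show "q \<le> q ^ 3" "q + 1 \<le> q ^ 3" "q ^ 3 \<le> q ^ 4" "1 \<le> q ^ 2" "3 \<le> q ^ 2"
      using assms(2) by linarith+
  qed
  have Y3: "real (q + 1 choose 3) = (r + 1) * Y" using r by (simp add: Y_def)
  have q3: "real (q choose 3) = (r - 2) * Y"
    using of_nat_choose_3_Suc[of q] r unfolding Y_def r_def by (simp add: field_simps)
  have Y4: "real (q + 1 choose 4) = (r + 1) * Y * (r - 2) / 4"
    unfolding of_nat_choose_4 Y3 by (simp add: r_def)
  have q4: "real (q choose 4) = (r - 2) * Y * (r - 3) / 4"
    unfolding of_nat_choose_4 q3 by (simp add: r_def)
  have c2: "real (q choose 2) = r * (r - 1) / 2" "real (q ^ 2 choose 2) = r ^ 2 * (r ^ 2 - 1) / 2"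
    by (simp_all add: of_nat_choose_2 r_def)
  have diffs: "real (q ^ 2 - 1) = r ^ 2 - 1" "real (q ^ 2 - 3) = r ^ 2 - 3"
    "real (q ^ 4 - q ^ 3) = r ^ 4 - r ^ 3" "real (q ^ 3 - q) = r ^ 3 - r"
    "real (q ^ 3 - (q + 1)) = r ^ 3 - (r + 1)"
    using le by (simp_all add: r_def of_nat_diff)
  have A: "real (card {S \<in> quadruples. \<exists>i. S \<subseteq> line i}) =
      r ^ 2 * ((r - 2) * Y * (r - 3) / 4) + (r ^ 4 - r ^ 3) * ((r + 1) * Y * (r - 2) / 4)"
    unfolding card_quadruples_on_lines of_nat_add of_nat_mult diffs q4 Y4 by (simp add: r_def)
  have V: "real (card {S \<in> quadruples. \<exists>x. S \<subseteq> line (Inl x)}) = r ^ 2 * real (q choose 4)"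
    unfolding card_quadruples_vertical by (simp add: r_def)
  have N: "real (card {S \<in> quadruples. \<exists>bc. S \<subseteq> line (Inr bc)}) = (r ^ 4 - r ^ 3) * ((r + 1) * Y * (r - 2) / 4)"
    unfolding card_quadruples_nonvertical of_nat_mult diffs Y4 ..
  have C: "real (card {S \<in> quadruples. \<exists>i. card (S \<inter> line i) = 3}) =
      r ^ 2 * ((r - 2) * Y * (r ^ 3 - r)) + (r ^ 4 - r ^ 3) * ((r + 1) * Y * (r ^ 3 - (r + 1)))"
    unfolding card_quadruples_three_collinear of_nat_add of_nat_mult diffs q3 Y3 by (simp add: r_def)
  show ?thesis
  proof (intro conjI)
    obtain g where g: "num_words q (corner_code_H0 q :: ('a \<times> 'a \<Rightarrow> 'a) set) 4 =
        card {S \<in> quadruples. \<exists>i. S \<subseteq> line i} * ((q ^ 2 - 1) * (q ^ 2 - 3)) + g * (q ^ 2 - 1)"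
      "g + card {S \<in> quadruples. \<exists>i. S \<subseteq> line i} + card {S \<in> quadruples. \<exists>i. card (S \<inter> line i) = 3}
        = q ^ 3 choose 4"
      using num_words_H0 by blast
    \<comment> \<open>The binomial \<open>q ^ 3\<close> over 3 stays symbolic, because both sides of
      the formula are linear in it.\<close>
    define X where "X = real (q ^ 3 choose 3)"
    have "real (q ^ 3 choose 4) = X * (r ^ 3 - 3) / 4"
      unfolding of_nat_choose_4 X_def by (simp add: r_def)
    then have g': "real g = X * (r ^ 3 - 3) / 4 - real (card {S \<in> quadruples. \<exists>i. S \<subseteq> line i})
        - real (card {S \<in> quadruples. \<exists>i. card (S \<inter> line i) = 3})"
      using arg_cong[OF g(2), of real] by simp
    show "real (num_words q (corner_code_H0 q :: ('a \<times> 'a \<Rightarrow> 'a) set) 4) =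
       1 / 4 * (real (q ^ 3 choose 3) * (real q + 1)
                - real q ^ 2 * real ((q + 1) choose 3) * (3 * real q ^ 3 + 2 * real q ^ 2 - 8))
         * (real q - 1) * (real q ^ 3 - 3)"
      unfolding g(1) of_nat_add of_nat_mult diffs g' A C Y3 X_def[symmetric] r_def[symmetric]
      by (simp add: field_simps) algebra
    \<comment> \<open>The first summand comes from vertical lines, with
      \<open>(r ^ 2 - 1) * (r ^ 2 - 3)\<close> expanded; the second is the number of two vertical
      pairs times \<open>r ^ 2 - 1\<close>.\<close>
    show "real (num_words q (edge_code_H1 q :: ('a \<times> 'a \<Rightarrow> 'a) set) 4) =
       real q ^ 2 * real (q choose 4) * (real q ^ 4 - 4 * real q ^ 2 + 3)
         + real q ^ 4 * (real q ^ 2 - 1) ^ 2 * (real q - 1) ^ 2 / 8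
         + (real q ^ 2 - 1)
             * (\<Sum>k = 4..2 * q. real (num_curves_meeting TYPE('a) q k) * real (k choose 4))"
      unfolding num_words_H1 of_nat_add of_nat_mult diffs V card_quadruples_on_curves
        card_two_vertical_pairs of_nat_power c2 of_nat_sum r_def[symmetric]
      by (simp add: field_simps) algebra
    \<comment> \<open>Both line counts are multiples of \<open>(r - 2) * Y / 4\<close>, which lets
      them combine into one binomial coefficient.\<close>
    show "real (num_words q (edge_code_H2 q :: ('a \<times> 'a \<Rightarrow> 'a) set) 4) =
       real q ^ 2 * (real q - 1) * real ((q + 1) choose 4)
         * (2 * real q ^ 3 - 3 * real q ^ 2 - 4 * real q + 9)"
      unfolding num_words_H2 of_nat_add of_nat_mult diffs V N q4 Y4 r_def[symmetric]
      by (simp add: field_simps) algebra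
  qed
qed

end
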